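(* Let $(X,T)$ be a topological dynamical system (a compact metric space $(X,d)$ with a homeomorphism $T:X\to X$), let $f\in C(X,\mathbb{R})$, and let $\mu$ be an ergodic $T$-invariant Borel probability measure on $X$ with measure-theoretic entropy $h_{\mu}(T)>0$. Then for $\mu$-a.e. $x\in X$, $$\lim_{\epsilon\to 0}P_s(T,f,x,\epsilon)\geq P_{\mu}(T,f).$$
   Context: For $x\in X$ and $\epsilon>0$, the $\epsilon$-stable set is $W^s_{\epsilon}(x,T)=\{y\in X: d(T^nx,T^ny)\le\epsilon \text{ for all } n=0,1,2,\dots\}$. Write $f_n(x)=\sum_{i=0}^{n-1}f(T^ix)$ and $d_n(x,y)=\max_{0\le i\le n-1}d(T^ix,T^iy)$. A set $E\subseteq K$ is $(n,\delta)$-separated if distinct $x,y\in E$ satisfy $d_n(x,y)>\delta$. For a nonempty subset $K\subseteq X$ put $P_n(T,f,\delta,K)=\sup\{\sum_{x\in E}\exp f_n(x): E \text{ an } (n,\delta)\text{-separated subset of } K\}$. The topological pressure of the preimages of the $\epsilon$-stable set of $x$ is $$P_s(T,f,x,\epsilon)=\lim_{\delta\to0}\limsup_{n\to+\infty}\frac1n\log P_n(T,f,\delta,T^{-n}W^s_{\epsilon}(x,T)).$$ The measure-theoretic pressure is $P_{\mu}(T,f)=h_{\mu}(T)+\int_X f\,d\mu$. *)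

theory Defs
  imports "HOL-Probability.Probability"
begin

definition tds :: "'a::metric_space set \<Rightarrow> ('a \<Rightarrow> 'a) \<Rightarrow> bool" where
  "tds X T \<longleftrightarrow> compact X \<and> X \<noteq> {} \<and> (\<exists>S. homeomorphism X X T S)"

definition stable_set :: "('a::metric_space \<Rightarrow> 'a) \<Rightarrow> 'a set \<Rightarrow> 'a \<Rightarrow> real \<Rightarrow> 'a set" where
  "stable_set T X x \<epsilon> = {y \<in> X. \<forall>n::nat. dist ((T^^n) x) ((T^^n) y) \<le> \<epsilon>}"

definition birkhoff_sum :: "('a \<Rightarrow> 'a) \<Rightarrow> ('a \<Rightarrow> real) \<Rightarrow> nat \<Rightarrow> 'a \<Rightarrow> real" where
  "birkhoff_sum T f n x = (\<Sum>i<n. f ((T^^i) x))"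

definition bowen_dist :: "('a::metric_space \<Rightarrow> 'a) \<Rightarrow> nat \<Rightarrow> 'a \<Rightarrow> 'a \<Rightarrow> real" where
  "bowen_dist T n x y = Max ((\<lambda>i. dist ((T^^i) x) ((T^^i) y)) ` {..<n})"

definition separated :: "('a::metric_space \<Rightarrow> 'a) \<Rightarrow> nat \<Rightarrow> real \<Rightarrow> 'a set \<Rightarrow> 'a set \<Rightarrow> bool" where
  "separated T n \<delta> K E \<longleftrightarrow> E \<subseteq> K \<and> (\<forall>x\<in>E. \<forall>y\<in>E. x \<noteq> y \<longrightarrow> bowen_dist T n x y > \<delta>)"

text \<open>P_n(T,f,delta,K). In a compact space separated sets are automatically finite.\<close>
definition Pn :: "('a::metric_space \<Rightarrow> 'a) \<Rightarrow> ('a \<Rightarrow> real) \<Rightarrow> nat \<Rightarrow> real \<Rightarrow> 'a set \<Rightarrow> real" where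
  "Pn T f n \<delta> K = Sup {(\<Sum>x\<in>E. exp (birkhoff_sum T f n x)) | E. finite E \<and> separated T n \<delta> K E}"

definition Ps :: "('a::metric_space \<Rightarrow> 'a) \<Rightarrow> 'a set \<Rightarrow> ('a \<Rightarrow> real) \<Rightarrow> 'a \<Rightarrow> real \<Rightarrow> ereal" where
  "Ps T X f x \<epsilon> = Lim (at_right 0) (\<lambda>\<delta>::real.
      limsup (\<lambda>n. ereal (ln (Pn T f n \<delta> ((T^^n) -` stable_set T X x \<epsilon> \<inter> X)) / real n)))"

definition borel_prob_on :: "'a::metric_space set \<Rightarrow> 'a measure \<Rightarrow> bool" where
  "borel_prob_on X \<mu> \<longleftrightarrow> prob_space \<mu> \<and> space \<mu> = X \<and> sets \<mu> = sets (restrict_space borel X)"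

definition invariant_measure :: "'a set \<Rightarrow> ('a \<Rightarrow> 'a) \<Rightarrow> 'a measure \<Rightarrow> bool" where
  "invariant_measure X T \<mu> \<longleftrightarrow> (\<forall>A\<in>sets \<mu>. measure \<mu> (T -` A \<inter> X) = measure \<mu> A)"

definition ergodic_measure :: "'a set \<Rightarrow> ('a \<Rightarrow> 'a) \<Rightarrow> 'a measure \<Rightarrow> bool" where
  "ergodic_measure X T \<mu> \<longleftrightarrow> invariant_measure X T \<mu> \<and>
     (\<forall>A\<in>sets \<mu>. T -` A \<inter> X = A \<longrightarrow> measure \<mu> A = 0 \<or> measure \<mu> A = 1)"

definition finite_partition :: "'a set \<Rightarrow> 'a measure \<Rightarrow> 'a set set \<Rightarrow> bool" where
  "finite_partition X \<mu> \<xi> \<longleftrightarrow> finite \<xi> \<and> \<xi> \<subseteq> sets \<mu> \<and> \<Union>\<xi> = X \<and> {} \<notin> \<xi> \<and>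
     (\<forall>A\<in>\<xi>. \<forall>B\<in>\<xi>. A \<noteq> B \<longrightarrow> A \<inter> B = {})"

definition part_entropy :: "'a measure \<Rightarrow> 'a set set \<Rightarrow> real" where
  "part_entropy \<mu> \<xi> = - (\<Sum>A\<in>\<xi>. measure \<mu> A * ln (measure \<mu> A))"

definition join_part :: "'a set \<Rightarrow> ('a \<Rightarrow> 'a) \<Rightarrow> 'a set set \<Rightarrow> nat \<Rightarrow> 'a set set" where
  "join_part X T \<xi> n = {(\<Inter>i<n. (T^^i) -` a i \<inter> X) | a. \<forall>i<n. a i \<in> \<xi>} - {{}}"

definition entropy_rel :: "'a set \<Rightarrow> ('a \<Rightarrow> 'a) \<Rightarrow> 'a measure \<Rightarrow> 'a set set \<Rightarrow> real" where
  "entropy_rel X T \<mu> \<xi> = lim (\<lambda>n. part_entropy \<mu> (join_part X T \<xi> n) / real n)"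

definition ks_entropy :: "'a set \<Rightarrow> ('a \<Rightarrow> 'a) \<Rightarrow> 'a measure \<Rightarrow> ereal" where
  "ks_entropy X T \<mu> = (SUP \<xi>\<in>{\<xi>. finite_partition X \<mu> \<xi>}. ereal (entropy_rel X T \<mu> \<xi>))"

definition measure_pressure :: "'a set \<Rightarrow> ('a \<Rightarrow> 'a) \<Rightarrow> ('a \<Rightarrow> real) \<Rightarrow> 'a measure \<Rightarrow> ereal" where
  "measure_pressure X T f \<mu> = ks_entropy X T \<mu> + ereal (integral\<^sup>L \<mu> f)"

end

(* Fix a finite measurable partition into sets of diameter at most eps and write h for its entropy.
   If x and y have the same itinerary at all times >= 0, then y lies in the eps-stable set of x; so
   the points z whose itinerary from time n on agrees with that of x lie in the n-th preimage of that
   set. Given the itinerary at times n, ..., n + k - 1, a typical z has an initial n-word of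
   conditional probability at most exp (- n (h - eta)), uniformly in k. This lower half of the
   Shannon-McMillan theorem only needs L2-convergence of conditional probabilities (monotone square
   norms), truncation of the information function and the ergodic theorem. Hence the conditioning
   cell contains about exp (n h) words. A Bowen delta-ball around a typical point meets only
   subexponentially many of them: outside a set V of small measure, delta-close points are in the same
   partition element, so words of delta-close orbits are close in Hamming distance. A maximal
   separated set in a typical cell therefore has at least exp (n (h - 3 eta)) points, each with
   Birkhoff sum close to n times the integral of f. Compactness replaces k by infinity, which avoids
   disintegration of measures; and failure with small probability for each large n suffices, because
   the pressure is a limsup in n. *)

theory Submission
  imports Defs
begin

section \<open>The ergodic theorem\<close>

text \<open>The order of the quantifiers is the difficulty. The scale \<delta> has to be fixed
  before n, k and the error probability, since the pressure lets \<delta> shrink only after the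
  limsup in n; and the threshold for n must not depend on k, since k tends to infinity first, at
  fixed n. For the latter, the information of the first n letters given the next k is split into n
  one-step terms. The j-th is conditioned on n + k - 1 - j \<ge> k letters, so for large k all of
  them are close in mean to one fixed function, and the ergodic theorem is applied to that function
  alone. The obstacle is the logarithm, unbounded near 0: truncation at level L costs in mean at
  most the number of letters times \<open>exp (- L)\<close>, because the inverse of the conditional
  probability of the observed letter has mean at most the number of letters.

  The bad event is a set of points x, while the count runs over points z whose n-th image shares the
  k-word of x; invariance of the measure identifies the two probabilities.\<close>

locale invariant_prob = prob_space M for M :: "'a measure" +
  fixes T :: "'a \<Rightarrow> 'a"
  assumes T_measurable [measurable]: "T \<in> M \<rightarrow>\<^sub>M M"
    and T_invariant: "A \<in> sets M \<Longrightarrow> prob (T -` A \<inter> space M) = prob A"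
begin

lemma funpow_measurable [measurable]: "(T ^^ n) \<in> M \<rightarrow>\<^sub>M M"
  by (induction n) (auto simp: measurable_comp)

lemma funpow_space: "x \<in> space M \<Longrightarrow> (T ^^ n) x \<in> space M"
  by (rule measurable_space[OF funpow_measurable])

lemma T_space: "x \<in> space M \<Longrightarrow> T x \<in> space M"
  by (rule measurable_space[OF T_measurable])

lemma distr_T: "distr M M T = M"
  by (rule measure_eqI) (auto simp: emeasure_distr emeasure_eq_measure T_invariant)

lemma distr_funpow: "distr M M (T ^^ n) = M"
proof (induction n)
  case 0
  then show ?case by (simp add: distr_id2 id_def)
next
  case (Suc n)
  have "distr M M (T ^^ Suc n) = distr (distr M M (T ^^ n)) M T"
    by (subst distr_distr) auto
  then show ?case by (simp only: Suc distr_T)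
qed

lemma prob_vimage_funpow: "A \<in> sets M \<Longrightarrow> prob ((T ^^ n) -` A \<inter> space M) = prob A"
  by (metis distr_funpow funpow_measurable measure_distr)

lemma integral_funpow:
  fixes g :: "'a \<Rightarrow> real"
  assumes "g \<in> borel_measurable M"
  shows "(\<integral>x. g ((T ^^ n) x) \<partial>M) = (\<integral>x. g x \<partial>M)"
  using integral_distr[OF funpow_measurable assms, of n] by (simp add: distr_funpow)

lemma integrable_funpow:
  fixes g :: "'a \<Rightarrow> real"
  assumes "integrable M g"
  shows "integrable M (\<lambda>x. g ((T ^^ n) x))"
  by (rule integrable_distr[OF funpow_measurable]) (simp add: distr_funpow assms)

lemma birkhoff_sum_measurable [measurable]:
  assumes [measurable]: "g \<in> borel_measurable M"
  shows "birkhoff_sum T g n \<in> borel_measurable M"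
  unfolding birkhoff_sum_def by measurable

end

lemma birkhoff_sum_Suc: "birkhoff_sum T g (Suc n) x = g x + birkhoff_sum T g n (T x)"
  unfolding birkhoff_sum_def by (subst sum.lessThan_Suc_shift) (simp add: funpow_swap1)

text \<open>The indicators of failure tend to 0 almost everywhere and are bounded by 1, so dominated
  convergence applies.\<close>

lemma (in prob_space) AE_eventually_imp_prob_tendsto_0:
  assumes [measurable]: "\<And>n. {x \<in> space M. P n x} \<in> sets M"
    and ae: "AE x in M. \<forall>\<^sub>F n in sequentially. P n x"
  shows "(\<lambda>n. prob {x \<in> space M. \<not> P n x}) \<longlonglongrightarrow> 0"
proof -
  have m: "{x \<in> space M. \<not> P n x} \<in> sets M" for n by measurable
  have "(\<lambda>n. \<integral>x. indicator {x \<in> space M. \<not> P n x} x \<partial>M) \<longlonglongrightarrow> (\<integral>x. (0::real) \<partial>M)"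
  proof (rule integral_dominated_convergence[where w = "\<lambda>_. 1"])
    show "AE x in M. (\<lambda>n. indicator {x \<in> space M. \<not> P n x} x) \<longlonglongrightarrow> (0::real)"
      using ae
    proof eventually_elim
      case (elim x)
      show ?case
        by (rule tendsto_eventually, rule eventually_mono[OF elim]) (auto simp: indicator_def)
    qed
  qed (use m in \<open>auto simp: indicator_def\<close>)
  then show ?thesis using m by simp
qed

locale ergodic_prob = invariant_prob +
  assumes ergodic: "A \<in> sets M \<Longrightarrow> T -` A \<inter> space M = A \<Longrightarrow> prob A = 0 \<or> prob A = 1"
begin

text \<open>\<open>maxsum g n\<close> is the maximum of the Birkhoff sums of length at most \<open>n\<close>.\<close>

primrec maxsum :: "('a \<Rightarrow> real) \<Rightarrow> nat \<Rightarrow> 'a \<Rightarrow> real" where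
  "maxsum g 0 x = 0"
| "maxsum g (Suc n) x = max 0 (g x + maxsum g n (T x))"

lemma maxsum_nonneg: "0 \<le> maxsum g n x"
  by (cases n) auto

lemma maxsum_mono_Suc: "maxsum g n x \<le> maxsum g (Suc n) x"
proof (induction n arbitrary: x)
  case (Suc n)
  show ?case using Suc[of "T x"] by simp
qed simp

lemma maxsum_mono: "m \<le> n \<Longrightarrow> maxsum g m x \<le> maxsum g n x"
  by (rule lift_Suc_mono_le[of "\<lambda>n. maxsum g n x"]) (rule maxsum_mono_Suc)

lemma birkhoff_le_maxsum: "birkhoff_sum T g n x \<le> maxsum g n x"
proof (induction n arbitrary: x)
  case (Suc n)
  show ?case using Suc[of "T x"] by (simp add: birkhoff_sum_Suc)
qed (simp add: birkhoff_sum_def)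

lemma maxsum_integrable: "integrable M g \<Longrightarrow> integrable M (maxsum g n)"
proof (induction n)
  case 0
  have "maxsum g 0 = (\<lambda>_. 0)" by auto
  then show ?case by simp
next
  case (Suc n)
  have "integrable M (\<lambda>x. maxsum g n (T x))"
    using integrable_funpow[OF Suc.IH[OF Suc.prems], of 1] by simp
  then have "integrable M (\<lambda>x. max 0 (g x + maxsum g n (T x)))"
    using Suc.prems by (intro integrable_max) auto
  then show ?case by simp
qed

text \<open>The set where the maximal sums are unbounded is invariant, hence null or of full
  measure. If it were full, the functions \<open>D n\<close> would have nonnegative integrals and
  converge to \<open>g\<close>, against the negative mean.\<close>

lemma AE_maxsum_bounded:
  assumes g: "integrable M g" and neg: "(\<integral>x. g x \<partial>M) < 0"
  shows "AE x in M. \<exists>B. \<forall>n. maxsum g n x \<le> B"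
proof -
  have mm[measurable]: "maxsum g n \<in> borel_measurable M" for n
    using maxsum_integrable[OF g] by auto
  have [measurable]: "g \<in> borel_measurable M" using g by auto
  define A where "A = {x \<in> space M. \<forall>k::nat. \<exists>n. maxsum g n x > real k}"
  have A[measurable]: "A \<in> sets M" unfolding A_def by measurable
  have inv: "T -` A \<inter> space M = A"
  proof (intro equalityI subsetI)
    fix x assume x: "x \<in> T -` A \<inter> space M"
    have "\<exists>n. maxsum g n x > real k" for k
    proof -
      obtain j :: nat where j: "real j \<ge> real k + \<bar>g x\<bar>" by (meson real_arch_simple)
      obtain n where "maxsum g n (T x) > real j" using x by (auto simp: A_def)
      then have "maxsum g (Suc n) x > real k" using j by (simp add: max_def abs_if split: if_splits)
      then show ?thesis by blast
    qed
    then show "x \<in> A" using x by (auto simp: A_def)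
  next
    fix x assume x: "x \<in> A"
    have "\<exists>n. maxsum g n (T x) > real k" for k
    proof -
      obtain j :: nat where j: "real j \<ge> real k + \<bar>g x\<bar>" by (meson real_arch_simple)
      obtain n where n: "maxsum g n x > real j" using x by (auto simp: A_def)
      then have "maxsum g (Suc n) x > real j" using maxsum_mono_Suc[of g n x] by linarith
      then have "maxsum g n (T x) > real k"
        using j by (simp add: max_def abs_if split: if_splits)
      then show ?thesis by blast
    qed
    then show "x \<in> T -` A \<inter> space M" using x T_space by (auto simp: A_def)
  qed
  have "prob A = 0"
  proof (rule ccontr)
    assume "prob A \<noteq> 0"
    then have "prob A = 1" using ergodic[OF A inv] by blast
    then have aeA: "AE x in M. x \<in> A" using A by (simp add: prob_eq_1)
    \<comment> \<open>This is \<open>g x\<close> cut off from below at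
      \<open>- maxsum g n (T x)\<close>; on \<open>A\<close> the cut-off disappears for large n. In
      the form \<open>Deq\<close> its integral is the increase of the integral of
      \<open>maxsum\<close>, by invariance.\<close>
    define D where "D n x = max (- maxsum g n (T x)) (g x)" for n x
    have Deq: "D n x = maxsum g (Suc n) x - maxsum g n (T x)" for n x
      by (simp add: D_def max_def)
    have "(\<lambda>n. \<integral>x. D n x \<partial>M) \<longlonglongrightarrow> (\<integral>x. g x \<partial>M)"
    proof (rule integral_dominated_convergence[where w = "\<lambda>x. \<bar>g x\<bar>"])
      show "AE x in M. (\<lambda>n. D n x) \<longlonglongrightarrow> g x"
        using aeA
      proof eventually_elim
        case (elim x)
        then have "T x \<in> A" using inv by blast
        obtain k :: nat where k: "real k \<ge> \<bar>g x\<bar>" by (meson real_arch_simple)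
        obtain n0 where n0: "maxsum g n0 (T x) > real k" using \<open>T x \<in> A\<close> by (auto simp: A_def)
        show ?case
        proof (rule tendsto_eventually, rule eventually_sequentiallyI[of n0])
          fix n assume "n0 \<le> n"
          then have "maxsum g n (T x) > real k" using n0 maxsum_mono[of n0 n g "T x"] by linarith
          then show "D n x = g x" using k by (simp add: D_def)
        qed
      qed
      show "AE x in M. norm (D n x) \<le> \<bar>g x\<bar>" for n
      proof (rule AE_I2)
        fix x
        show "norm (D n x) \<le> \<bar>g x\<bar>" using maxsum_nonneg[of g n "T x"] by (auto simp: D_def)
      qed
      show "D n \<in> borel_measurable M" for n unfolding D_def by measurable
    qed (use g in auto)
    moreover have "(\<integral>x. D n x \<partial>M) \<ge> 0" for n
    proof -
      have i: "integrable M (\<lambda>x. maxsum g n (T x))"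
        using integrable_funpow[OF maxsum_integrable[OF g], of n 1] by simp
      have "(\<integral>x. maxsum g n (T x) \<partial>M) = (\<integral>x. maxsum g n x \<partial>M)"
        using integral_funpow[OF mm, of n 1] by simp
      then have "(\<integral>x. D n x \<partial>M) = (\<integral>x. maxsum g (Suc n) x \<partial>M) - (\<integral>x. maxsum g n x \<partial>M)"
        unfolding Deq
        using Bochner_Integration.integral_diff[OF maxsum_integrable[OF g, of "Suc n"] i]
        by (simp del: maxsum.simps)
      moreover have "(\<integral>x. maxsum g n x \<partial>M) \<le> (\<integral>x. maxsum g (Suc n) x \<partial>M)"
        by (intro integral_mono maxsum_integrable g maxsum_mono_Suc)
      ultimately show ?thesis by linarith
    qed
    ultimately have "(\<integral>x. g x \<partial>M) \<ge> 0" by (meson LIMSEQ_le_const)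
    with neg show False by simp
  qed
  then have "AE x in M. x \<notin> A"
    using A by (intro AE_not_in) (simp add: null_sets_def emeasure_eq_measure)
  then show ?thesis
    by (rule AE_mp) (intro AE_I2, auto simp: A_def not_less)
qed

text \<open>Bounded maximal sums of \<open>c' - g\<close> say that the Birkhoff sums of
  \<open>g\<close> stay above c' n - B, and the slack c' - c absorbs B. Upper bounds are obtained
  from the same statement for the negated function.\<close>

theorem birkhoff_lower:
  assumes g: "integrable M g" and c: "c < (\<integral>x. g x \<partial>M)"
  shows "AE x in M. \<forall>\<^sub>F n in sequentially. c * real n < birkhoff_sum T g n x"
proof -
  obtain c' where c': "c < c'" "c' < (\<integral>x. g x \<partial>M)" using c dense by blast
  have "AE x in M. \<exists>B. \<forall>n. maxsum (\<lambda>x. c' - g x) n x \<le> B"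
  proof (rule AE_maxsum_bounded)
    have "(\<integral>x. c' - g x \<partial>M) = c' - (\<integral>x. g x \<partial>M)"
      using g by (simp add: prob_space)
    then show "(\<integral>x. c' - g x \<partial>M) < 0" using c' by simp
  qed (use g in auto)
  then show ?thesis
  proof eventually_elim
    case (elim x)
    then obtain B where B: "maxsum (\<lambda>x. c' - g x) n x \<le> B" for n by blast
    have low: "c' * real n - birkhoff_sum T g n x \<le> B" for n
      using birkhoff_le_maxsum[of "\<lambda>x. c' - g x" n x] B[of n]
      by (simp add: birkhoff_sum_def sum_subtractf mult.commute)
    obtain N :: nat where N: "real N > B / (c' - c)" using reals_Archimedean2 by blast
    show ?case
    proof (rule eventually_sequentiallyI[of N])
      fix n assume "N \<le> n"
      then have "B / (c' - c) < real n" using N by linarith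
      then have "B < (c' - c) * real n" using c' by (simp add: field_simps)
      then show "c * real n < birkhoff_sum T g n x"
        using low[of n] by (simp add: algebra_simps)
    qed
  qed
qed

lemma birkhoff_lower_prob:
  assumes g: "integrable M g" and c: "c < (\<integral>x. g x \<partial>M)"
  shows "(\<lambda>n. prob {x \<in> space M. \<not> c * real n < birkhoff_sum T g n x}) \<longlonglongrightarrow> 0"
proof (rule AE_eventually_imp_prob_tendsto_0[OF _ birkhoff_lower[OF g c]])
  have [measurable]: "g \<in> borel_measurable M" using g by auto
  show "{x \<in> space M. c * real n < birkhoff_sum T g n x} \<in> sets M" for n by measurable
qed

end

section \<open>Conditional probabilities of fibers\<close>

context prob_space
begin

text \<open>A finite partition is encoded by a simple function with the cells as fibers. The
  probability of a cell becomes a function of the point, so that entropies are integrals of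
  \<open>- ln (fiber_prob q z)\<close>.\<close>

definition fiber_prob :: "('a \<Rightarrow> 'b) \<Rightarrow> 'a \<Rightarrow> real" where
  "fiber_prob q z = prob {y \<in> space M. q y = q z}"

text \<open>An explicit version of the conditional expectation of the indicator of \<open>A\<close>
  given \<open>q\<close>, possible because finitely many values are conditioned on.\<close>

definition cond_prob_fiber :: "'a set \<Rightarrow> ('a \<Rightarrow> 'b) \<Rightarrow> 'a \<Rightarrow> real" where
  "cond_prob_fiber A q z = prob (A \<inter> {y \<in> space M. q y = q z}) / fiber_prob q z"

lemma simple_function_fiber_sets:
  assumes "simple_function M q"
  shows "{y \<in> space M. q y = v} \<in> sets M"
proof -
  have "q -` {v} \<inter> space M \<in> sets M" using assms by (rule simple_functionD)
  also have "q -` {v} \<inter> space M = {y \<in> space M. q y = v}" by auto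
  finally show ?thesis .
qed

lemma simple_function_indicator_eq_sum:
  fixes \<phi> :: "'b \<Rightarrow> real"
  assumes q: "simple_function M q" and z: "z \<in> space M"
  shows "\<phi> (q z) * indicator A z
    = (\<Sum>v\<in>q ` space M. \<phi> v * indicator (A \<inter> {y \<in> space M. q y = v}) z)"
proof -
  have "(\<Sum>v\<in>q ` space M. \<phi> v * indicator (A \<inter> {y \<in> space M. q y = v}) z)
      = (\<Sum>v\<in>q ` space M. if v = q z then \<phi> v * indicator A z else 0)"
    by (intro sum.cong) (auto simp: indicator_def z)
  also have "\<dots> = \<phi> (q z) * indicator A z"
    using z simple_functionD(1)[OF q] by (simp add: sum.delta)
  finally show ?thesis by simp
qed

lemma simple_function_integral_indicator:
  fixes \<phi> :: "'b \<Rightarrow> real"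
  assumes q: "simple_function M q" and [measurable]: "A \<in> sets M"
  shows "integrable M (\<lambda>z. \<phi> (q z) * indicator A z)"
    and "(\<integral>z. \<phi> (q z) * indicator A z \<partial>M)
      = (\<Sum>v\<in>q ` space M. \<phi> v * prob (A \<inter> {y \<in> space M. q y = v}))"
proof -
  have [measurable]: "{y \<in> space M. q y = v} \<in> sets M" for v
    by (rule simple_function_fiber_sets[OF q])
  let ?s = "\<lambda>z. \<Sum>v\<in>q ` space M. \<phi> v * indicator (A \<inter> {y \<in> space M. q y = v}) z"
  have i: "integrable M (\<lambda>z. \<phi> v * indicator (A \<inter> {y \<in> space M. q y = v}) z)" for v
    by (intro integrable_mult_right integrable_real_indicator) (auto simp: less_top[symmetric])
  have "integrable M ?s" by (intro Bochner_Integration.integrable_sum i)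
  moreover have eq: "\<phi> (q z) * indicator A z = ?s z" if "z \<in> space M" for z
    by (rule simple_function_indicator_eq_sum[OF q that])
  ultimately show "integrable M (\<lambda>z. \<phi> (q z) * indicator A z)"
    by (subst Bochner_Integration.integrable_cong[OF refl eq])
  have "(\<integral>z. \<phi> (q z) * indicator A z \<partial>M) = (\<integral>z. ?s z \<partial>M)"
    by (rule Bochner_Integration.integral_cong[OF refl eq])
  also have "\<dots> = (\<Sum>v\<in>q ` space M. \<phi> v * prob (A \<inter> {y \<in> space M. q y = v}))"
  proof (subst Bochner_Integration.integral_sum[OF i], rule sum.cong[OF refl])
    fix v
    have "A \<inter> {y \<in> space M. q y = v} \<inter> space M = A \<inter> {y \<in> space M. q y = v}" by auto
    then show "(\<integral>z. \<phi> v * indicator (A \<inter> {y \<in> space M. q y = v}) z \<partial>M)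
        = \<phi> v * prob (A \<inter> {y \<in> space M. q y = v})" by simp
  qed
  finally show "(\<integral>z. \<phi> (q z) * indicator A z \<partial>M)
      = (\<Sum>v\<in>q ` space M. \<phi> v * prob (A \<inter> {y \<in> space M. q y = v}))" .
qed

lemma simple_function_integral:
  fixes \<phi> :: "'b \<Rightarrow> real"
  assumes q: "simple_function M q"
  shows "integrable M (\<lambda>z. \<phi> (q z))"
    and "(\<integral>z. \<phi> (q z) \<partial>M) = (\<Sum>v\<in>q ` space M. \<phi> v * prob {y \<in> space M. q y = v})"
proof -
  have eq: "\<phi> (q z) * indicator (space M) z = \<phi> (q z)" if "z \<in> space M" for z
    using that by simp
  show "integrable M (\<lambda>z. \<phi> (q z))"
    using simple_function_integral_indicator(1)[OF q sets.top, of \<phi>]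
    by (subst (asm) Bochner_Integration.integrable_cong[OF refl eq])
  have "(\<integral>z. \<phi> (q z) \<partial>M) = (\<integral>z. \<phi> (q z) * indicator (space M) z \<partial>M)"
    by (rule Bochner_Integration.integral_cong[OF refl eq[symmetric]])
  also have "\<dots> = (\<Sum>v\<in>q ` space M. \<phi> v * prob {y \<in> space M. q y = v})"
    unfolding simple_function_integral_indicator(2)[OF q sets.top]
    by (intro sum.cong refl arg_cong2[where f="(*)"] arg_cong[where f=prob]) auto
  finally show "(\<integral>z. \<phi> (q z) \<partial>M) = (\<Sum>v\<in>q ` space M. \<phi> v * prob {y \<in> space M. q y = v})" .
qed

lemma integrable_fiber_fun:
  fixes F :: "'b \<Rightarrow> real"
  assumes "simple_function M q" and "\<And>z. z \<in> space M \<Longrightarrow> f z = F (q z)"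
  shows "integrable M f"
  using simple_function_integral(1)[OF assms(1), of F] assms(2)
  by (subst Bochner_Integration.integrable_cong[OF refl]) auto

lemma cond_prob_fiber_nonneg: "0 \<le> cond_prob_fiber A q z"
  by (simp add: cond_prob_fiber_def fiber_prob_def)

lemma cond_prob_fiber_le_1:
  assumes "simple_function M q"
  shows "cond_prob_fiber A q z \<le> 1"
proof -
  have "prob (A \<inter> {y \<in> space M. q y = q z}) \<le> fiber_prob q z"
    unfolding fiber_prob_def
    by (intro finite_measure_mono simple_function_fiber_sets[OF assms]) auto
  then show ?thesis
    by (simp add: cond_prob_fiber_def divide_le_eq fiber_prob_def)
qed

text \<open>Null fibers, where the conditional probability is the junk value 0/0, do not matter.\<close>

lemma integral_cond_prob_fiber:
  fixes F :: "'b \<Rightarrow> real"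
  assumes q: "simple_function M q" and A: "A \<in> sets M"
  shows "(\<integral>z. F (q z) * cond_prob_fiber A q z \<partial>M) = (\<integral>z. F (q z) * indicator A z \<partial>M)"
proof -
  let ?p = "\<lambda>v. prob {y \<in> space M. q y = v}" and ?a = "\<lambda>v. prob (A \<inter> {y \<in> space M. q y = v})"
  have "(\<integral>z. F (q z) * cond_prob_fiber A q z \<partial>M) = (\<Sum>v\<in>q ` space M. F v * (?a v / ?p v) * ?p v)"
    unfolding cond_prob_fiber_def fiber_prob_def
    using simple_function_integral(2)[OF q, of "\<lambda>v. F v * (?a v / ?p v)"] by simp
  also have "\<dots> = (\<Sum>v\<in>q ` space M. F v * ?a v)"
  proof (rule sum.cong[OF refl])
    fix v
    have "?a v \<le> ?p v"
      by (intro finite_measure_mono simple_function_fiber_sets[OF q]) auto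
    then show "F v * (?a v / ?p v) * ?p v = F v * ?a v"
      using measure_nonneg[of M "A \<inter> {y \<in> space M. q y = v}"] by (cases "?p v = 0") auto
  qed
  also have "\<dots> = (\<integral>z. F (q z) * indicator A z \<partial>M)"
    by (rule simple_function_integral_indicator(2)[OF q A, symmetric])
  finally show ?thesis .
qed

lemma integrable_cond_prob_fiber_mult:
  fixes F :: "'b \<Rightarrow> real"
  assumes "simple_function M q"
  shows "integrable M (\<lambda>z. F (q z) * cond_prob_fiber A q z)"
  by (rule integrable_fiber_fun[OF assms, where
        F="\<lambda>v. F v * (prob (A \<inter> {y \<in> space M. q y = v}) / prob {y \<in> space M. q y = v})"])
     (simp add: cond_prob_fiber_def fiber_prob_def)

text \<open>Conditioning on the coarser function is an orthogonal projection in L2 of the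
  conditioning on the finer one.\<close>

lemma cond_prob_fiber_pythagoras:
  assumes q: "simple_function M q" and r: "simple_function M r"
    and coarser: "\<And>z. z \<in> space M \<Longrightarrow> q z = \<phi> (r z)"
    and A: "A \<in> sets M"
  shows "integrable M (\<lambda>z. (cond_prob_fiber A r z - cond_prob_fiber A q z)\<^sup>2)"
    and "(\<integral>z. (cond_prob_fiber A r z - cond_prob_fiber A q z)\<^sup>2 \<partial>M)
      = (\<integral>z. (cond_prob_fiber A r z)\<^sup>2 \<partial>M) - (\<integral>z. (cond_prob_fiber A q z)\<^sup>2 \<partial>M)"
proof -
  let ?a = "cond_prob_fiber A q" and ?b = "cond_prob_fiber A r"
  define G where "G v = prob (A \<inter> {y \<in> space M. q y = v}) / prob {y \<in> space M. q y = v}" for v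
  define G' where "G' v = prob (A \<inter> {y \<in> space M. r y = v}) / prob {y \<in> space M. r y = v}" for v
  have a: "?a z = G (q z)" for z by (simp add: G_def cond_prob_fiber_def fiber_prob_def)
  have b: "?b z = G' (r z)" for z by (simp add: G'_def cond_prob_fiber_def fiber_prob_def)
  have a': "?a z = G (\<phi> (r z))" if "z \<in> space M" for z using a coarser[OF that] by simp
  have i1: "integrable M (\<lambda>z. (?a z)\<^sup>2)"
    by (rule integrable_fiber_fun[OF q, where F="\<lambda>v. (G v)\<^sup>2"]) (simp add: a)
  have i2: "integrable M (\<lambda>z. (?b z)\<^sup>2)"
    by (rule integrable_fiber_fun[OF r, where F="\<lambda>v. (G' v)\<^sup>2"]) (simp add: b)
  have i3: "integrable M (\<lambda>z. ?a z * ?b z)"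
    by (rule integrable_fiber_fun[OF r, where F="\<lambda>v. G (\<phi> v) * G' v"]) (simp add: a' b)
  \<comment> \<open>The mixed term: \<open>?a\<close> is a function of \<open>r\<close>, so
    \<open>?b\<close> may be replaced by the indicator of \<open>A\<close>; as a function of
    \<open>q\<close> it then lets the indicator be replaced by \<open>?a\<close>.\<close>
  have "(\<integral>z. ?a z * ?b z \<partial>M) = (\<integral>z. G (\<phi> (r z)) * ?b z \<partial>M)"
    by (intro Bochner_Integration.integral_cong) (auto simp: a')
  also have "\<dots> = (\<integral>z. G (\<phi> (r z)) * indicator A z \<partial>M)"
    by (rule integral_cond_prob_fiber[OF r A, of "\<lambda>v. G (\<phi> v)"])
  also have "\<dots> = (\<integral>z. G (q z) * indicator A z \<partial>M)"
    by (intro Bochner_Integration.integral_cong) (auto simp: coarser)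
  also have "\<dots> = (\<integral>z. (?a z)\<^sup>2 \<partial>M)"
    unfolding integral_cond_prob_fiber[OF q A, of G, symmetric] by (simp add: a power2_eq_square)
  finally have ab: "(\<integral>z. ?a z * ?b z \<partial>M) = (\<integral>z. (?a z)\<^sup>2 \<partial>M)" .
  have eq: "(?b z - ?a z)\<^sup>2 = (?b z)\<^sup>2 + (?a z)\<^sup>2 - 2 * (?a z * ?b z)" for z
    by (simp add: power2_eq_square algebra_simps)
  show "integrable M (\<lambda>z. (?b z - ?a z)\<^sup>2)" unfolding eq using i1 i2 i3 by auto
  show "(\<integral>z. (?b z - ?a z)\<^sup>2 \<partial>M) = (\<integral>z. (?b z)\<^sup>2 \<partial>M) - (\<integral>z. (?a z)\<^sup>2 \<partial>M)"
    unfolding eq using i1 i2 i3 by (simp add: ab)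
qed

text \<open>A substitute for martingale convergence: the squared norms increase by Pythagoras and
  are at most 1, so beyond some \<open>K\<close> they grow by at most the square of
  \<open>e\<close>. No limit function is constructed; everything is compared with the one at
  \<open>K\<close>.\<close>

lemma cond_prob_fiber_Cauchy_L1:
  fixes r :: "nat \<Rightarrow> 'a \<Rightarrow> 'b"
  assumes r: "\<And>m. simple_function M (r m)"
    and coarser: "\<And>m l z. m \<le> l \<Longrightarrow> z \<in> space M \<Longrightarrow> r m z = \<phi> m l (r l z)"
    and A: "A \<in> sets M" and e: "e > 0"
  shows "\<exists>K. \<forall>m\<ge>K. (\<integral>z. \<bar>cond_prob_fiber A (r m) z - cond_prob_fiber A (r K) z\<bar> \<partial>M) \<le> e"
proof -
  let ?c = "\<lambda>m. cond_prob_fiber A (r m)"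
  define E where "E m = (\<integral>z. (?c m z)\<^sup>2 \<partial>M)" for m
  have pyth: "(\<integral>z. (?c l z - ?c m z)\<^sup>2 \<partial>M) = E l - E m"
    and int: "integrable M (\<lambda>z. (?c l z - ?c m z)\<^sup>2)" if "m \<le> l" for m l
    unfolding E_def using cond_prob_fiber_pythagoras[OF r r coarser[OF that] A] by auto
  have "incseq E"
  proof (rule incseq_SucI)
    fix m
    have "0 \<le> (\<integral>z. (?c (Suc m) z - ?c m z)\<^sup>2 \<partial>M)" by simp
    then show "E m \<le> E (Suc m)" using pyth[of m "Suc m"] by simp
  qed
  moreover have "E m \<le> 1" for m
  proof -
    have "E m \<le> (\<integral>z. 1 \<partial>M)"
      unfolding E_def
      by (rule integral_mono_AE') 
        (auto simp: power_le_one cond_prob_fiber_nonneg cond_prob_fiber_le_1[OF r])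
    then show ?thesis by (simp add: prob_space)
  qed
  ultimately obtain L where L: "E \<longlonglongrightarrow> L" "\<And>m. E m \<le> L"
    by (metis incseq_convergent)
  have "L - e\<^sup>2 < L" using e by simp
  then obtain K where K: "\<And>m. m \<ge> K \<Longrightarrow> E m > L - e\<^sup>2"
    using order_tendstoD(1)[OF L(1)] unfolding eventually_sequentially by blast
  show ?thesis
  proof (intro exI[of _ K] allI impI)
    fix m assume m: "K \<le> m"
    let ?d = "\<lambda>z. ?c m z - ?c K z"
    \<comment> \<open>Passes from L2 to L1 by the inequality of arithmetic and geometric means; with
      a squared distance of at most \<open>e\<^sup>2\<close> both summands are at most
      \<open>e\<close>.\<close>
    have le: "\<bar>x\<bar> \<le> (x\<^sup>2 / e + e) / 2" for x :: real
    proof -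
      have "0 \<le> (\<bar>x\<bar> - e)\<^sup>2" by simp
      also have "\<dots> = x\<^sup>2 + e\<^sup>2 - 2 * e * \<bar>x\<bar>" by (simp add: power2_eq_square algebra_simps)
      finally show ?thesis using e by (simp add: field_simps power2_eq_square)
    qed
    have "(\<integral>z. \<bar>?d z\<bar> \<partial>M) \<le> (\<integral>z. ((?d z)\<^sup>2 / e + e) / 2 \<partial>M)"
      using int[OF m] le e by (intro integral_mono_AE') auto
    also have "\<dots> = ((\<integral>z. (?d z)\<^sup>2 \<partial>M) / e + e) / 2"
      using int[OF m] by (simp add: prob_space)
    also have "\<dots> = ((E m - E K) / e + e) / 2" using pyth[OF m] by simp
    also have "\<dots> \<le> e"
    proof -
      have "E m - E K \<le> e\<^sup>2" using L(2)[of m] K[of K] by simp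
      then have "(E m - E K) / e \<le> e" using e by (simp add: divide_le_eq power2_eq_square)
      then show ?thesis by simp
    qed
    finally show "(\<integral>z. \<bar>?d z\<bar> \<partial>M) \<le> e" .
  qed
qed

text \<open>There are finitely many fibers, so the null ones together form a null set. This keeps
  the logarithms below away from 0 almost everywhere.\<close>

lemma AE_fiber_prob_pos:
  assumes q: "simple_function M q"
  shows "AE z in M. fiber_prob q z > 0"
proof -
  have "AE z in M. \<forall>v\<in>q ` space M. prob {y \<in> space M. q y = v} = 0 \<longrightarrow> q z \<noteq> v"
  proof (intro AE_finite_allI simple_functionD(1)[OF q])
    fix v
    show "AE z in M. prob {y \<in> space M. q y = v} = 0 \<longrightarrow> q z \<noteq> v"
    proof (cases "prob {y \<in> space M. q y = v} = 0")
      case True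
      then have "{y \<in> space M. q y = v} \<in> null_sets M"
        using simple_function_fiber_sets[OF q, of v]
        by (simp add: null_sets_def emeasure_eq_measure)
      from AE_not_in[OF this] show ?thesis
        by (rule AE_mp) (intro AE_I2, auto)
    qed simp
  qed
  then show ?thesis
    by (rule AE_mp) (intro AE_I2, auto simp: fiber_prob_def zero_less_measure_iff)
qed

end

text \<open>The itinerary of z at times 0, ..., n - 1. Lists make the initial word followed by the
  conditioning word a plain concatenation, and the recursion splits off the letter at time 0, as the
  one-step informations require.\<close>

primrec wrd :: "('a \<Rightarrow> 'a) \<Rightarrow> ('a \<Rightarrow> 'b) \<Rightarrow> nat \<Rightarrow> 'a \<Rightarrow> 'b list" where
  "wrd T q 0 z = []"
| "wrd T q (Suc n) z = q z # wrd T q n (T z)"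

lemma length_wrd [simp]: "length (wrd T q n z) = n"
  by (induction n arbitrary: z) auto

lemma nth_wrd: "i < n \<Longrightarrow> wrd T q n z ! i = q ((T ^^ i) z)"
proof (induction n arbitrary: z i)
  case (Suc n)
  then show ?case by (cases i) (auto simp: funpow_swap1)
qed simp

lemma wrd_add: "wrd T q (n + k) z = wrd T q n z @ wrd T q k ((T ^^ n) z)"
  by (induction n arbitrary: z) (auto simp: funpow_swap1)

lemma take_wrd: "m \<le> n \<Longrightarrow> take m (wrd T q n z) = wrd T q m z"
  using wrd_add[of T q m "n - m" z] by simp

lemma wrd_eq_iff: "wrd T q n y = wrd T q n z \<longleftrightarrow> (\<forall>i<n. q ((T ^^ i) y) = q ((T ^^ i) z))"
  by (simp add: list_eq_iff_nth_eq nth_wrd)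

section \<open>Information functions and entropy\<close>

context invariant_prob
begin

lemma simple_function_wrd:
  assumes q: "simple_function M q"
  shows "simple_function M (wrd T q n)"
proof (induction n)
  case 0
  show ?case by (subst simple_function_cong[where g="\<lambda>_. []"]) auto
next
  case (Suc n)
  have "simple_function M (\<lambda>z. wrd T q n (T z))"
    by (rule simple_function_comp[OF T_measurable Suc])
  from simple_function_compose2[OF q this, of "(#)"] show ?case
    by (subst simple_function_cong[where g="\<lambda>z. q z # wrd T q n (T z)"]) auto
qed

lemma simple_function_wrd_T:
  "simple_function M q \<Longrightarrow> simple_function M (\<lambda>z. wrd T q n (T z))"
  by (intro simple_function_comp[OF T_measurable] simple_function_wrd)

lemma fiber_prob_wrd_T:
  assumes q: "simple_function M q" and z: "z \<in> space M"
  shows "fiber_prob (\<lambda>z. wrd T q n (T z)) z = fiber_prob (wrd T q n) (T z)"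
proof -
  have "{y \<in> space M. wrd T q n (T y) = wrd T q n (T z)}
      = T -` {y \<in> space M. wrd T q n y = wrd T q n (T z)} \<inter> space M"
    using T_space by auto
  then show ?thesis
    unfolding fiber_prob_def
    using T_invariant[OF simple_function_fiber_sets[OF simple_function_wrd[OF q]]] by simp
qed

text \<open>The conditional probability of the letter at time 0 given the letters at times 1, ..., m.\<close>

definition first_prob :: "('a \<Rightarrow> 'b) \<Rightarrow> nat \<Rightarrow> 'a \<Rightarrow> real" where
  "first_prob q m z = fiber_prob (wrd T q (Suc m)) z / fiber_prob (wrd T q m) (T z)"

text \<open>The quotient form telescopes along orbits; the conditional form is the one that
  converges in mean. Here the event depends on z, so convergence has to be applied letter by
  letter.\<close>

lemma first_prob_eq_cond:
  assumes q: "simple_function M q" and z: "z \<in> space M"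
  shows "first_prob q m z = cond_prob_fiber {y \<in> space M. q y = q z} (\<lambda>z. wrd T q m (T z)) z"
proof -
  have "{y \<in> space M. wrd T q (Suc m) y = wrd T q (Suc m) z}
    = {y \<in> space M. q y = q z} \<inter> {y \<in> space M. wrd T q m (T y) = wrd T q m (T z)}" by auto
  then show ?thesis
    unfolding first_prob_def cond_prob_fiber_def fiber_prob_wrd_T[OF q z]
    by (simp add: fiber_prob_def)
qed

lemma first_prob_eq_sum:
  assumes q: "simple_function M q" and z: "z \<in> space M"
  shows "F (first_prob q m z) = (\<Sum>v\<in>q ` space M. indicator {y \<in> space M. q y = v} z *
    (F (cond_prob_fiber {y \<in> space M. q y = v} (\<lambda>z. wrd T q m (T z)) z) :: real))"
proof -
  have "(\<Sum>v\<in>q ` space M. indicator {y \<in> space M. q y = v} z *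
      F (cond_prob_fiber {y \<in> space M. q y = v} (\<lambda>z. wrd T q m (T z)) z))
    = (\<Sum>v\<in>q ` space M. if v = q z then F (first_prob q m z) else 0)"
    by (intro sum.cong) (auto simp: indicator_def z first_prob_eq_cond[OF q])
  then show ?thesis using z simple_functionD(1)[OF q] by (simp add: sum.delta)
qed

lemma simple_function_first_prob:
  assumes q: "simple_function M q"
  shows "simple_function M (first_prob q m)"
proof -
  have a: "simple_function M (fiber_prob r)" if "simple_function M r" for r :: "'a \<Rightarrow> 'b list"
    unfolding fiber_prob_def by (rule simple_function_compose1[OF that])
  have "simple_function M (\<lambda>z. fiber_prob (wrd T q m) (T z))"
    by (rule simple_function_comp[OF T_measurable a[OF simple_function_wrd[OF q]]])
  from simple_function_compose2[OF a[OF simple_function_wrd[OF q, of "Suc m"]] this, of "(/)"]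
  show ?thesis unfolding first_prob_def .
qed

lemma fiber_prob_wrd_Suc_le:
  assumes q: "simple_function M q" and z: "z \<in> space M"
  shows "fiber_prob (wrd T q (Suc m)) z \<le> fiber_prob (wrd T q m) (T z)"
proof -
  have "fiber_prob (wrd T q (Suc m)) z \<le> fiber_prob (\<lambda>z. wrd T q m (T z)) z"
    unfolding fiber_prob_def
    by (intro finite_measure_mono simple_function_fiber_sets simple_function_wrd_T[OF q]) auto
  then show ?thesis using fiber_prob_wrd_T[OF q z] by simp
qed

lemma AE_first_prob_pos:
  assumes q: "simple_function M q"
  shows "AE z in M. first_prob q m z > 0"
  using AE_fiber_prob_pos[OF simple_function_wrd[OF q, of "Suc m"]]
proof (rule AE_mp, intro AE_I2 impI)
  fix z assume "z \<in> space M" "0 < fiber_prob (wrd T q (Suc m)) z"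
  then show "first_prob q m z > 0"
    using fiber_prob_wrd_Suc_le[OF q, of z m] unfolding first_prob_def by simp
qed

text \<open>Truncating the information at \<open>L\<close> makes it a Lipschitz function of the probability, so that
  it inherits convergence in mean.\<close>

definition trunc_info :: "('a \<Rightarrow> 'b) \<Rightarrow> real \<Rightarrow> nat \<Rightarrow> 'a \<Rightarrow> real" where
  "trunc_info q L m z = - ln (max (first_prob q m z) (exp (- L)))"

lemma simple_function_imp_integrable:
  "simple_function M f \<Longrightarrow> integrable M f" for f :: "'a \<Rightarrow> real"
  using simple_function_integral(1)[of f "\<lambda>x. x"] by simp

lemma simple_function_trunc_info:
  assumes q: "simple_function M q"
  shows "simple_function M (trunc_info q L m)"
  using simple_function_compose1[OF simple_function_first_prob[OF q],
      of "\<lambda>p. - ln (max p (exp (- L)))" m] unfolding trunc_info_def .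

text \<open>On [exp (- L), \<infinity>) the logarithm is Lipschitz with constant exp L, and the
  maximum with a constant does not increase distances.\<close>

lemma ln_max_diff_le:
  fixes x y L :: real
  shows "\<bar>ln (max x (exp (- L))) - ln (max y (exp (- L)))\<bar> \<le> exp L * \<bar>x - y\<bar>"
proof -
  have *: "ln (max x (exp (- L))) - ln (max y (exp (- L))) \<le> exp L * \<bar>x - y\<bar>" for x y :: real
  proof -
    let ?x = "max x (exp (- L))" and ?y = "max y (exp (- L))"
    have pos: "0 < ?x" "0 < ?y" by (simp_all add: less_max_iff_disj)
    have "ln ?x - ln ?y = ln (?x / ?y)" using pos by (simp add: ln_div)
    also have "\<dots> \<le> ?x / ?y - 1" using pos by (intro ln_le_minus_one) simp
    also have "\<dots> = (?x - ?y) / ?y" using pos by (simp add: field_simps)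
    also have "\<dots> \<le> \<bar>?x - ?y\<bar> / ?y" using pos by (intro divide_right_mono) auto
    also have "\<dots> \<le> \<bar>?x - ?y\<bar> / exp (- L)" using pos by (intro divide_left_mono) auto
    also have "\<dots> \<le> \<bar>x - y\<bar> / exp (- L)" by (intro divide_right_mono) auto
    finally show ?thesis by (simp add: exp_minus field_simps)
  qed
  from *[of x y] *[of y x] show ?thesis by (simp add: abs_le_iff abs_minus_commute)
qed

text \<open>The difference at z involves only the letter \<open>q z\<close>; bounding it by the sum
  over all letters gives events that no longer depend on z.\<close>

lemma trunc_info_Cauchy:
  assumes q: "simple_function M q" and e: "e > 0"
  shows "\<exists>K. \<forall>m\<ge>K. (\<integral>z. \<bar>trunc_info q L m z - trunc_info q L K z\<bar> \<partial>M) \<le> e"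
proof -
  let ?V = "q ` space M" and ?A = "\<lambda>v. {y \<in> space M. q y = v}"
  let ?c = "\<lambda>v m z. cond_prob_fiber (?A v) (\<lambda>z. wrd T q m (T z)) z"
  have fin: "finite ?V" by (rule simple_functionD(1)[OF q])
  \<comment> \<open>The factor \<open>exp L\<close> is the Lipschitz constant, the 2 pays for
    comparing both m and \<open>N\<close> with the threshold \<open>K v\<close> of each letter, and
    the 1 keeps the denominator positive without discussing an empty alphabet.\<close>
  define e' where "e' = e / (exp L * (2 * (1 + real (card ?V))))"
  have e': "e' > 0" using e by (simp add: e'_def add_pos_nonneg)
  have ex: "\<exists>K. \<forall>m\<ge>K. (\<integral>z. \<bar>?c v m z - ?c v K z\<bar> \<partial>M) \<le> e'" for v
  proof (rule cond_prob_fiber_Cauchy_L1[where r="\<lambda>m z. wrd T q m (T z)" and \<phi>="\<lambda>m l. take m"])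
    show "simple_function M (\<lambda>z. wrd T q m (T z))" for m by (rule simple_function_wrd_T[OF q])
    show "?A v \<in> sets M" by (rule simple_function_fiber_sets[OF q])
  qed (simp_all add: take_wrd e')
  define K where "K v = (SOME K. \<forall>m\<ge>K. (\<integral>z. \<bar>?c v m z - ?c v K z\<bar> \<partial>M) \<le> e')" for v
  have K: "(\<integral>z. \<bar>?c v m z - ?c v (K v) z\<bar> \<partial>M) \<le> e'" if "m \<ge> K v" for v m
    using someI_ex[OF ex[of v]] that unfolding K_def by blast
  define N where "N = (if ?V = {} then 0 else Max (K ` ?V))"
  have N: "K v \<le> N" if "v \<in> ?V" for v using that fin by (auto simp: N_def)
  have c_int: "integrable M (?c v m)" for v m
    using integrable_cond_prob_fiber_mult[OF simple_function_wrd_T[OF q], of "\<lambda>_. 1" m "?A v"]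
    by simp
  show ?thesis
  proof (intro exI[of _ N] allI impI)
    fix m assume m: "N \<le> m"
    have dist: "(\<integral>z. \<bar>?c v m z - ?c v N z\<bar> \<partial>M) \<le> 2 * e'" if v: "v \<in> ?V" for v
    proof -
      have "(\<integral>z. \<bar>?c v m z - ?c v N z\<bar> \<partial>M)
          \<le> (\<integral>z. \<bar>?c v m z - ?c v (K v) z\<bar> + \<bar>?c v N z - ?c v (K v) z\<bar> \<partial>M)"
        using c_int by (intro integral_mono) auto
      also have "\<dots> = (\<integral>z. \<bar>?c v m z - ?c v (K v) z\<bar> \<partial>M) + (\<integral>z. \<bar>?c v N z - ?c v (K v) z\<bar> \<partial>M)"
        using c_int by (intro Bochner_Integration.integral_add) auto
      also have "\<dots> \<le> 2 * e'" using K[of v m] K[of v N] N[OF v] m by simp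
      finally show ?thesis .
    qed
    have "(\<integral>z. \<bar>trunc_info q L m z - trunc_info q L N z\<bar> \<partial>M)
        \<le> (\<integral>z. (\<Sum>v\<in>?V. exp L * \<bar>?c v m z - ?c v N z\<bar>) \<partial>M)"
    proof (rule integral_mono)
      fix z assume z: "z \<in> space M"
      have "\<bar>trunc_info q L m z - trunc_info q L N z\<bar>
          \<le> exp L * \<bar>first_prob q m z - first_prob q N z\<bar>"
        using ln_max_diff_le[of "first_prob q m z" L "first_prob q N z"]
        unfolding trunc_info_def by (simp add: abs_minus_commute)
      also have "\<dots> = exp L * \<bar>?c (q z) m z - ?c (q z) N z\<bar>"
        by (simp add: first_prob_eq_cond[OF q z])
      also have "\<dots> \<le> (\<Sum>v\<in>?V. exp L * \<bar>?c v m z - ?c v N z\<bar>)"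
        by (rule member_le_sum[of "q z" ?V "\<lambda>v. exp L * \<bar>?c v m z - ?c v N z\<bar>"])
          (use z fin in auto)
      finally show "\<bar>trunc_info q L m z - trunc_info q L N z\<bar>
          \<le> (\<Sum>v\<in>?V. exp L * \<bar>?c v m z - ?c v N z\<bar>)" .
    qed (use c_int simple_function_imp_integrable[OF simple_function_trunc_info[OF q]] in auto)
    also have "\<dots> = (\<Sum>v\<in>?V. exp L * (\<integral>z. \<bar>?c v m z - ?c v N z\<bar> \<partial>M))"
      using c_int by (subst Bochner_Integration.integral_sum) auto
    also have "\<dots> \<le> (\<Sum>v\<in>?V. exp L * (2 * e'))"
      by (intro sum_mono mult_left_mono dist) auto
    also have "\<dots> = e * (real (card ?V) / (1 + real (card ?V)))"
    proof -
      have "exp L * (2 * e') = e / (1 + real (card ?V))"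
        unfolding e'_def by (simp del: distrib_left_numeral)
      then show ?thesis by simp
    qed
    also have "\<dots> \<le> e * 1" using e by (intro mult_left_mono) auto
    finally show "(\<integral>z. \<bar>trunc_info q L m z - trunc_info q L N z\<bar> \<partial>M) \<le> e" by simp
  qed
qed

definition step_info :: "('a \<Rightarrow> 'b) \<Rightarrow> nat \<Rightarrow> 'a \<Rightarrow> real" where
  "step_info q m z = - ln (first_prob q m z)"

lemma simple_function_step_info:
  assumes q: "simple_function M q"
  shows "simple_function M (step_info q m)"
  using simple_function_compose1[OF simple_function_first_prob[OF q], of "\<lambda>p. - ln p" m]
  unfolding step_info_def .

text \<open>On the event of the letter v the integrand is the inverse of the conditional probability
  of v. Conditioning turns the indicator of that event into this probability, so each letter
  contributes at most 1.\<close>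

lemma integral_inverse_first_prob:
  assumes q: "simple_function M q"
  shows "(\<integral>z. 1 / first_prob q m z \<partial>M) \<le> card (q ` space M)"
proof -
  let ?V = "q ` space M" and ?A = "\<lambda>v. {y \<in> space M. q y = v}"
  let ?r = "\<lambda>z. wrd T q m (T z)"
  let ?c = "\<lambda>v z. cond_prob_fiber (?A v) ?r z"
  have r: "simple_function M ?r" by (rule simple_function_wrd_T[OF q])
  have A: "?A v \<in> sets M" for v by (rule simple_function_fiber_sets[OF q])
  define F where "F v w = 1 / (prob (?A v \<inter> {y \<in> space M. ?r y = w}) / prob {y \<in> space M. ?r y = w})" for v w
  have F: "1 / ?c v z = F v (?r z)" for v z
    by (simp add: F_def cond_prob_fiber_def fiber_prob_def)
  have i: "integrable M (\<lambda>z. indicator (?A v) z * (1 / ?c v z))" for v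
    using simple_function_integral_indicator(1)[OF r A, of "F v" v] unfolding F by (simp add: mult.commute)
  have "(\<integral>z. 1 / first_prob q m z \<partial>M)
      = (\<integral>z. (\<Sum>v\<in>?V. indicator (?A v) z * (1 / ?c v z)) \<partial>M)"
    by (intro Bochner_Integration.integral_cong refl first_prob_eq_sum[OF q, of _ "\<lambda>p. 1 / p"])
  also have "\<dots> = (\<Sum>v\<in>?V. \<integral>z. indicator (?A v) z * (1 / ?c v z) \<partial>M)"
    by (rule Bochner_Integration.integral_sum[OF i])
  also have "\<dots> \<le> (\<Sum>v\<in>?V. 1)"
  proof (rule sum_mono)
    fix v
    have "(\<integral>z. indicator (?A v) z * (1 / ?c v z) \<partial>M) = (\<integral>z. F v (?r z) * ?c v z \<partial>M)"
      unfolding F integral_cond_prob_fiber[OF r A] by (simp add: mult.commute)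
    \<comment> \<open>The product is 1 where the conditional probability is positive and 0 where it
      vanishes, as 1 / 0 = 0.\<close>
    also have "\<dots> \<le> (\<integral>z. 1 \<partial>M)"
      by (rule integral_mono_AE') (auto simp: F[symmetric])
    finally show "(\<integral>z. indicator (?A v) z * (1 / ?c v z) \<partial>M) \<le> 1" by (simp add: prob_space)
  qed
  finally show ?thesis by simp
qed

lemma trunc_info_le_step_info:
  assumes "first_prob q m z > 0"
  shows "trunc_info q L m z \<le> step_info q m z"
  using assms unfolding trunc_info_def step_info_def by simp

text \<open>Where the probability p is below exp (- L), truncation loses ln (exp (- L) / p) \<le>
  exp (- L) / p, and 1 / p has bounded mean. The point is that the error bound does not depend on
  m.\<close>

lemma integral_trunc_info:
  assumes q: "simple_function M q"
  shows "(\<integral>z. trunc_info q L m z \<partial>M) \<le> (\<integral>z. step_info q m z \<partial>M)"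
    and "(\<integral>z. step_info q m z \<partial>M) \<le> (\<integral>z. trunc_info q L m z \<partial>M) + card (q ` space M) * exp (- L)"
proof -
  note int = simple_function_imp_integrable[OF simple_function_trunc_info[OF q]]
    simple_function_imp_integrable[OF simple_function_step_info[OF q]]
    simple_function_imp_integrable[OF simple_function_compose1[OF simple_function_first_prob[OF q]]]
  show "(\<integral>z. trunc_info q L m z \<partial>M) \<le> (\<integral>z. step_info q m z \<partial>M)"
    by (rule integral_mono_AE[OF int(1,2)])
      (rule AE_mp[OF AE_first_prob_pos[OF q]], intro AE_I2 impI, rule trunc_info_le_step_info)
  have le: "step_info q m z \<le> trunc_info q L m z + exp (- L) * (1 / first_prob q m z)"
    if p: "first_prob q m z > 0" for z
  proof (cases "first_prob q m z \<ge> exp (- L)")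
    case True
    then show ?thesis using p unfolding step_info_def trunc_info_def by (simp add: max_def)
  next
    case False
    then have mx: "max (first_prob q m z) (exp (- L)) = exp (- L)" by simp
    have "step_info q m z - trunc_info q L m z = ln (exp (- L) / first_prob q m z)"
      unfolding step_info_def trunc_info_def mx using p by (simp add: ln_div)
    also have "\<dots> \<le> exp (- L) / first_prob q m z"
      using ln_le_minus_one[of "exp (- L) / first_prob q m z"] p by simp
    finally show ?thesis by simp
  qed
  have "(\<integral>z. step_info q m z \<partial>M) \<le> (\<integral>z. trunc_info q L m z + exp (- L) * (1 / first_prob q m z) \<partial>M)"
  proof (rule integral_mono_AE)
    show "AE z in M. step_info q m z \<le> trunc_info q L m z + exp (- L) * (1 / first_prob q m z)"
      using AE_first_prob_pos[OF q, of m] by eventually_elim (rule le)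
  qed (use int in auto)
  also have "\<dots> = (\<integral>z. trunc_info q L m z \<partial>M) + exp (- L) * (\<integral>z. 1 / first_prob q m z \<partial>M)"
    using int(1) int(3)[of "\<lambda>p. 1 / p" m]
    by (subst Bochner_Integration.integral_add)
      (auto intro!: Bochner_Integration.integral_mult_right integrable_mult_right
        simp del: times_divide_eq_right)
  also have "\<dots> \<le> (\<integral>z. trunc_info q L m z \<partial>M) + exp (- L) * card (q ` space M)"
    by (intro add_left_mono mult_left_mono integral_inverse_first_prob[OF q]) auto
  finally show "(\<integral>z. step_info q m z \<partial>M) \<le> (\<integral>z. trunc_info q L m z \<partial>M) + card (q ` space M) * exp (- L)"
    by (simp add: mult.commute)
qed

end

section \<open>Entropy as the limit of mean one-step informations\<close>

lemma Cesaro_mean_LIMSEQ: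
  fixes c :: "nat \<Rightarrow> real"
  assumes "c \<longlonglongrightarrow> L"
  shows "(\<lambda>n. (\<Sum>i<n. c i) / real n) \<longlonglongrightarrow> L"
proof (rule LIMSEQ_I)
  fix e :: real assume e: "0 < e"
  from LIMSEQ_D[OF assms, of "e / 2"] e obtain N where N: "\<And>i. i \<ge> N \<Longrightarrow> \<bar>c i - L\<bar> < e / 2"
    by auto
  define B where "B = (\<Sum>i<N. \<bar>c i - L\<bar>)"
  obtain N' :: nat where N': "real N' > 2 * B / e" using reals_Archimedean2 by blast
  show "\<exists>n0. \<forall>n\<ge>n0. norm ((\<Sum>i<n. c i) / real n - L) < e"
  proof (intro exI[of _ "max (Suc N) N'"] allI impI)
    fix n assume n: "max (Suc N) N' \<le> n"
    then have n0: "0 < n" "N \<le> n" by auto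
    have "\<bar>(\<Sum>i<n. c i) - real n * L\<bar> = \<bar>\<Sum>i<n. c i - L\<bar>"
      by (simp add: sum_subtractf)
    also have "\<dots> \<le> (\<Sum>i<n. \<bar>c i - L\<bar>)" by (rule sum_abs)
    also have "\<dots> = B + (\<Sum>i=N..<n. \<bar>c i - L\<bar>)"
      unfolding B_def using sum.atLeastLessThan_concat[of 0 N n "\<lambda>i. \<bar>c i - L\<bar>"] n0 by (simp add: atLeast0LessThan)
    also have "\<dots> \<le> B + (\<Sum>i=N..<n. e / 2)"
    proof (intro add_left_mono sum_mono)
      fix i assume "i \<in> {N..<n}"
      then show "\<bar>c i - L\<bar> \<le> e / 2" using N[of i] by simp
    qed
    also have "\<dots> \<le> B + real n * (e / 2)" using e by (simp add: mult_right_mono)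
    also have "\<dots> < real n * e"
    proof -
      have "2 * B / e < real n" using N' n by linarith
      then show ?thesis using e by (simp add: field_simps)
    qed
    finally have "\<bar>(\<Sum>i<n. c i) - real n * L\<bar> < real n * e" .
    moreover have "(\<Sum>i<n. c i) / real n - L = ((\<Sum>i<n. c i) - real n * L) / real n"
      using n0 by (simp add: field_simps)
    ultimately show "norm ((\<Sum>i<n. c i) / real n - L) < e"
      using n0 by (simp add: abs_divide divide_less_eq mult.commute)
  qed
qed

context invariant_prob
begin

definition word_entropy :: "('a \<Rightarrow> 'b) \<Rightarrow> nat \<Rightarrow> real" where
  "word_entropy q n = (\<integral>z. - ln (fiber_prob (wrd T q n) z) \<partial>M)"

lemma simple_function_fiber_prob:
  "simple_function M r \<Longrightarrow> simple_function M (fiber_prob r)"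
  unfolding fiber_prob_def by (rule simple_function_compose1)

text \<open>The chain rule for entropy: pointwise the difference is between the words at z and at T
  z, and invariance removes the shift after integration.\<close>

lemma integral_step_info:
  assumes q: "simple_function M q"
  shows "(\<integral>z. step_info q m z \<partial>M) = word_entropy q (Suc m) - word_entropy q m"
proof -
  let ?I = "\<lambda>m z. - ln (fiber_prob (wrd T q m) z)"
  have int: "integrable M (?I m)" for m
    using simple_function_imp_integrable[OF simple_function_compose1[
          OF simple_function_fiber_prob[OF simple_function_wrd[OF q]], of "\<lambda>x. - ln x" m]] .
  have iT: "integrable M (\<lambda>z. ?I m (T z))"
    using integrable_funpow[OF int[of m], of 1] by simp
  have "(\<integral>z. step_info q m z \<partial>M) = (\<integral>z. ?I (Suc m) z - ?I m (T z) \<partial>M)"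
  proof (rule integral_cong_AE)
    have "AE z in M. z \<in> space M" by simp
    then show "AE z in M. step_info q m z = ?I (Suc m) z - ?I m (T z)"
      using AE_fiber_prob_pos[OF simple_function_wrd[OF q, of "Suc m"]]
    proof eventually_elim
      case (elim z)
      then show ?case
        using fiber_prob_wrd_Suc_le[OF q, of z m] unfolding step_info_def first_prob_def
        by (simp add: ln_div del: wrd.simps)
    qed
    show "step_info q m \<in> borel_measurable M"
      using simple_function_step_info[OF q] by (rule borel_measurable_simple_function)
    show "(\<lambda>z. ?I (Suc m) z - ?I m (T z)) \<in> borel_measurable M"
      by (intro borel_measurable_diff borel_measurable_integrable int iT)
  qed
  also have "\<dots> = (\<integral>z. ?I (Suc m) z \<partial>M) - (\<integral>z. ?I m (T z) \<partial>M)"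
    by (rule Bochner_Integration.integral_diff[OF int iT])
  also have "(\<integral>z. ?I m (T z) \<partial>M) = (\<integral>z. ?I m z \<partial>M)"
    using integral_funpow[of "?I m" 1] int[of m] by simp
  finally show ?thesis unfolding word_entropy_def .
qed

lemma word_entropy_eq_sum:
  assumes q: "simple_function M q"
  shows "word_entropy q n = (\<Sum>m<n. \<integral>z. step_info q m z \<partial>M)"
proof -
  have "word_entropy q 0 = 0"
    by (simp add: word_entropy_def fiber_prob_def prob_space)
  then show ?thesis
    unfolding integral_step_info[OF q] by (simp add: sum_lessThan_telescope)
qed

text \<open>These conditional entropies are in fact decreasing; but the truncation estimates, which
  the pointwise bound needs anyway, give the Cauchy property without a convexity argument.\<close>

lemma convergent_step_info:
  assumes q: "simple_function M q"
  shows "convergent (\<lambda>m. \<integral>z. step_info q m z \<partial>M)"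
proof -
  let ?c = "\<lambda>m. \<integral>z. step_info q m z \<partial>M"
  have "Cauchy ?c"
  proof (rule metric_CauchyI)
    fix e :: real assume e: "0 < e"
    define k where "k = real (card (q ` space M))"
    \<comment> \<open>Keeps the cost of truncation below e / 4; with e / 8 for the truncated
      functions this stays under e / 2.\<close>
    define L where "L = ln (4 * (k + 1) / e)"
    have k: "0 \<le> k" by (simp add: k_def)
    have L: "k * exp (- L) < e / 4"
    proof -
      have "exp (- L) = e / (4 * (k + 1))" using e k unfolding L_def by (simp add: exp_minus)
      then have "k * exp (- L) = e / 4 * (k / (k + 1))" by simp
      also have "\<dots> < e / 4 * 1" using e k by (intro mult_strict_left_mono) auto
      finally show ?thesis by simp
    qed
    obtain K where K: "\<And>m. m \<ge> K \<Longrightarrow> (\<integral>z. \<bar>trunc_info q L m z - trunc_info q L K z\<bar> \<partial>M) \<le> e / 8"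
      using trunc_info_Cauchy[OF q, of "e / 8" L] e by auto
    have close: "\<bar>?c m - (\<integral>z. trunc_info q L K z \<partial>M)\<bar> < e / 2" if m: "m \<ge> K" for m
    proof -
      note int = simple_function_imp_integrable[OF simple_function_trunc_info[OF q]]
      have "\<bar>(\<integral>z. trunc_info q L m z \<partial>M) - (\<integral>z. trunc_info q L K z \<partial>M)\<bar>
          = \<bar>\<integral>z. trunc_info q L m z - trunc_info q L K z \<partial>M\<bar>"
        using int by (subst Bochner_Integration.integral_diff) auto
      also have "\<dots> \<le> (\<integral>z. \<bar>trunc_info q L m z - trunc_info q L K z\<bar> \<partial>M)"
        by (rule integral_abs_bound)
      also have "\<dots> \<le> e / 8" by (rule K[OF m])
      finally show ?thesis
        using integral_trunc_info[OF q, where L=L and m=m] L e unfolding k_def by linarith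
    qed
    show "\<exists>N. \<forall>m\<ge>N. \<forall>n\<ge>N. dist (?c m) (?c n) < e"
    proof (intro exI[of _ K] allI impI)
      fix m n assume "K \<le> m" "K \<le> n"
      then show "dist (?c m) (?c n) < e"
        using close[of m] close[of n] unfolding dist_real_def by linarith
    qed
  qed
  then show ?thesis by (rule Cauchy_convergent)
qed

text \<open>The entropy of T relative to the partition into fibers of \<open>q\<close>, taken as the
  limit of conditional entropies because these are what the information estimate sees; Cesaro means
  give the usual formula.\<close>

definition entropy_rate :: "('a \<Rightarrow> 'b) \<Rightarrow> real" where
  "entropy_rate q = lim (\<lambda>m. \<integral>z. step_info q m z \<partial>M)"

lemma step_info_LIMSEQ:
  "simple_function M q \<Longrightarrow> (\<lambda>m. \<integral>z. step_info q m z \<partial>M) \<longlonglongrightarrow> entropy_rate q"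
  unfolding entropy_rate_def using convergent_step_info convergent_LIMSEQ_iff by blast

lemma word_entropy_LIMSEQ:
  "simple_function M q \<Longrightarrow> (\<lambda>n. word_entropy q n / real n) \<longlonglongrightarrow> entropy_rate q"
  using Cesaro_mean_LIMSEQ[OF step_info_LIMSEQ[of q]] word_entropy_eq_sum[of q] by simp

lemma word_entropy_mono:
  assumes q: "simple_function M q" and r: "simple_function M r"
    and coarser: "\<And>z. z \<in> space M \<Longrightarrow> q z = \<phi> (r z)"
  shows "word_entropy q n \<le> word_entropy r n"
  unfolding word_entropy_def
proof (rule integral_mono_AE)
  show "AE z in M. - ln (fiber_prob (wrd T q n) z) \<le> - ln (fiber_prob (wrd T r n) z)"
    using AE_fiber_prob_pos[OF simple_function_wrd[OF r, of n]]
  proof (rule AE_mp, intro AE_I2 impI)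
    fix z assume z: "z \<in> space M" and pos: "0 < fiber_prob (wrd T r n) z"
    have "{y \<in> space M. wrd T r n y = wrd T r n z} \<subseteq> {y \<in> space M. wrd T q n y = wrd T q n z}"
      using z by (auto simp: wrd_eq_iff coarser funpow_space)
    then have "fiber_prob (wrd T r n) z \<le> fiber_prob (wrd T q n) z"
      unfolding fiber_prob_def
      by (intro finite_measure_mono simple_function_fiber_sets simple_function_wrd q)
    then show "- ln (fiber_prob (wrd T q n) z) \<le> - ln (fiber_prob (wrd T r n) z)"
      using pos by simp
  qed
qed (use simple_function_imp_integrable[OF simple_function_compose1[
          OF simple_function_fiber_prob[OF simple_function_wrd], of _ "\<lambda>x. - ln x"]] q r in auto)

text \<open>Allows a partition to be refined to small diameter without losing entropy.\<close>

lemma entropy_rate_mono: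
  assumes "simple_function M q" and "simple_function M r"
    and "\<And>z. z \<in> space M \<Longrightarrow> q z = \<phi> (r z)"
  shows "entropy_rate q \<le> entropy_rate r"
  by (rule LIMSEQ_le[OF word_entropy_LIMSEQ[OF assms(1)] word_entropy_LIMSEQ[OF assms(2)]])
    (auto intro!: divide_right_mono word_entropy_mono[OF assms])

text \<open>The one-step probabilities along the orbit multiply to a ratio of word probabilities.
  The step at time j is conditioned on times j + 1, ..., n + k - 1, whose number is n + k - 1 - j.
  Truncation only decreases the sum. Positivity of the remaining word is carried along because the
  induction divides by it.\<close>

lemma sum_trunc_info_le:
  assumes q: "simple_function M q" and z: "z \<in> space M"
    and pos: "0 < fiber_prob (wrd T q (n + k)) z"
  shows "0 < fiber_prob (wrd T q k) ((T ^^ n) z) \<and>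
    (\<Sum>j<n. trunc_info q L (n + k - 1 - j) ((T ^^ j) z))
      \<le> ln (fiber_prob (wrd T q k) ((T ^^ n) z)) - ln (fiber_prob (wrd T q (n + k)) z)"
  using z pos
proof (induction n arbitrary: z)
  case 0
  then show ?case by simp
next
  case (Suc n)
  let ?P = "\<lambda>n. fiber_prob (wrd T q n)"
  have p1: "0 < ?P (Suc (n + k)) z" using Suc.prems by (simp del: wrd.simps)
  have p2: "0 < ?P (n + k) (T z)"
    using p1 fiber_prob_wrd_Suc_le[OF q Suc.prems(1), of "n + k"] by linarith
  note IH = Suc.IH[OF T_space[OF Suc.prems(1)] p2]
  have "0 < first_prob q (n + k) z" using p1 p2 unfolding first_prob_def by simp
  from trunc_info_le_step_info[OF this, of L]
  have 1: "trunc_info q L (n + k) z \<le> ln (?P (n + k) (T z)) - ln (?P (Suc (n + k)) z)"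
    using p1 p2 unfolding step_info_def first_prob_def by (simp add: ln_div del: wrd.simps)
  have "(\<Sum>j<Suc n. trunc_info q L (Suc n + k - 1 - j) ((T ^^ j) z))
      = trunc_info q L (n + k) z + (\<Sum>j<n. trunc_info q L (n + k - 1 - j) ((T ^^ j) (T z)))"
    by (subst sum.lessThan_Suc_shift) (simp add: funpow_swap1)
  with 1 IH show ?case by (simp add: funpow_swap1 del: wrd.simps)
qed

end

context ergodic_prob
begin

text \<open>The lower half of the Shannon--McMillan theorem, in probability and relative to the
  \<^term>\<open>k\<close> letters that follow the first \<^term>\<open>n\<close>; the point is uniformity in \<^term>\<open>k\<close>.\<close>

lemma conditional_information_lower:
  assumes q: "simple_function M q" and \<eta>: "\<eta> > 0" and e: "e > 0"
  shows "\<exists>K N. \<forall>n\<ge>N. \<forall>k\<ge>K. prob {z \<in> space M. fiber_prob (wrd T q (n + k)) z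
    > exp (- (real n * (entropy_rate q - \<eta>))) * fiber_prob (wrd T q k) ((T ^^ n) z)} \<le> e"
proof -
  let ?h = "entropy_rate q"
  define c where "c = real (card (q ` space M))"
  \<comment> \<open>Makes the cost of truncation less than \<eta> / 4.\<close>
  define L where "L = ln (4 * (c + 1) / \<eta>)"
  have c: "0 \<le> c" by (simp add: c_def)
  have L: "c * exp (- L) < \<eta> / 4"
  proof -
    have "exp (- L) = \<eta> / (4 * (c + 1))" using \<eta> c unfolding L_def by (simp add: exp_minus)
    then have "c * exp (- L) = \<eta> / 4 * (c / (c + 1))" by simp
      also have "\<dots> < \<eta> / 4 * 1" using \<eta> c by (intro mult_strict_left_mono) auto
      finally show ?thesis by simp
  qed
  let ?g = "trunc_info q L"
  note sg = simple_function_trunc_info[OF q, of L]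
  note ig = simple_function_imp_integrable[OF sg]
  obtain K1 where K1: "\<And>m. m \<ge> K1 \<Longrightarrow> (\<integral>z. \<bar>?g m z - ?g K1 z\<bar> \<partial>M) \<le> e * \<eta> / 32"
    using trunc_info_Cauchy[OF q, of "e * \<eta> / 32" L] e \<eta> by auto
  obtain K2 where K2: "\<And>m. m \<ge> K2 \<Longrightarrow> \<bar>(\<integral>z. step_info q m z \<partial>M) - ?h\<bar> < \<eta> / 4"
    using LIMSEQ_D[OF step_info_LIMSEQ[OF q], of "\<eta> / 4"] \<eta> by auto
  define K where "K = max K1 K2"
  have K: "(\<integral>z. \<bar>?g m z - ?g K z\<bar> \<partial>M) \<le> e * \<eta> / 16" if m: "m \<ge> K" for m
  proof -
    have "(\<integral>z. \<bar>?g m z - ?g K z\<bar> \<partial>M) \<le> (\<integral>z. \<bar>?g m z - ?g K1 z\<bar> + \<bar>?g K z - ?g K1 z\<bar> \<partial>M)"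
      using ig by (intro integral_mono) auto
    also have "\<dots> = (\<integral>z. \<bar>?g m z - ?g K1 z\<bar> \<partial>M) + (\<integral>z. \<bar>?g K z - ?g K1 z\<bar> \<partial>M)"
      using ig by (intro Bochner_Integration.integral_add) auto
    also have "\<dots> \<le> e * \<eta> / 16" using K1[of m] K1[of K] m by (simp add: K_def)
    finally show ?thesis .
  qed
  \<comment> \<open>The limit \<open>K2\<close> and the truncation lose less than \<eta> / 4 each;
    the remaining slack gives the strict inequality that the ergodic theorem asks for.\<close>
  have gK: "(\<integral>z. ?g K z \<partial>M) > ?h - 3 * \<eta> / 4"
  proof -
    have "\<bar>(\<integral>z. step_info q K z \<partial>M) - ?h\<bar> < \<eta> / 4" by (rule K2) (simp add: K_def)
    then show ?thesis using integral_trunc_info(2)[OF q, of K L] L unfolding c_def by linarith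
  qed
  have "0 < e / 2" using e by simp
  from order_tendstoD(2)[OF birkhoff_lower_prob[OF ig gK] this]
  obtain N0 where N0: "\<And>n. n \<ge> N0 \<Longrightarrow>
      prob {z \<in> space M. \<not> (?h - 3 * \<eta> / 4) * real n < birkhoff_sum T (?g K) n z} < e / 2"
    unfolding eventually_sequentially by auto
  show ?thesis
  proof (rule exI[of _ "Suc K"], rule exI[of _ "Suc N0"], intro allI impI)
    fix n k assume n: "Suc N0 \<le> n" and k: "Suc K \<le> k"
    have [measurable]: "?g m \<in> borel_measurable M" for m
      using sg by (rule borel_measurable_simple_function)
    \<comment> \<open>The total error of replacing all conditioning lengths along the orbit by the
      single length \<open>K\<close>. Its mean is at most n e \<eta> / 16, so Markov's inequality at
      level n \<eta> / 8 bounds its failure by e / 2. The threshold for n thus comes from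
      \<open>?g K\<close> alone and does not involve k.\<close>
    define d where "d z = (\<Sum>j<n. \<bar>?g (n + k - 1 - j) ((T ^^ j) z) - ?g K ((T ^^ j) z)\<bar>)" for z
    have [measurable]: "d \<in> borel_measurable M" unfolding d_def by measurable
    have idj: "integrable M (\<lambda>z. \<bar>?g m ((T ^^ j) z) - ?g K ((T ^^ j) z)\<bar>)" for m j
      by (intro integrable_abs Bochner_Integration.integrable_diff integrable_funpow ig)
    have int_d: "integrable M d" unfolding d_def by (intro Bochner_Integration.integrable_sum idj)
    have "(\<integral>z. d z \<partial>M) = (\<Sum>j<n. \<integral>z. \<bar>?g (n + k - 1 - j) ((T ^^ j) z) - ?g K ((T ^^ j) z)\<bar> \<partial>M)"
      unfolding d_def by (rule Bochner_Integration.integral_sum[OF idj])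
    also have "\<dots> = (\<Sum>j<n. \<integral>z. \<bar>?g (n + k - 1 - j) z - ?g K z\<bar> \<partial>M)"
      by (intro sum.cong refl integral_funpow[where g="\<lambda>z. \<bar>?g _ z - ?g K z\<bar>"]) measurable
    also have "\<dots> \<le> (\<Sum>j<n. e * \<eta> / 16)"
      using k by (intro sum_mono K) auto
    finally have Ed: "(\<integral>z. d z \<partial>M) \<le> real n * (e * \<eta> / 16)" by simp
    have pos: "0 < real n * (\<eta> / 8)" using n \<eta> by simp
    have nonneg: "AE z in M. 0 \<le> d z" unfolding d_def by (intro AE_I2 sum_nonneg) simp
    have "prob {z \<in> space M. real n * (\<eta> / 8) \<le> d z} \<le> (\<integral>z. d z \<partial>M) / (real n * (\<eta> / 8))"
      by (rule integral_Markov_inequality_measure[OF int_d sets.empty_sets nonneg pos])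
    also have "\<dots> \<le> real n * (e * \<eta> / 16) / (real n * (\<eta> / 8))"
      using n \<eta> by (intro divide_right_mono Ed) auto
    also have "\<dots> = e / 2" using n \<eta> by (simp add: field_simps)
    finally have D: "prob {z \<in> space M. real n * (\<eta> / 8) \<le> d z} \<le> e / 2" .
    let ?B = "{z \<in> space M. \<not> (?h - 3 * \<eta> / 4) * real n < birkhoff_sum T (?g K) n z}"
    let ?D = "{z \<in> space M. real n * (\<eta> / 8) \<le> d z}"
    let ?E = "{z \<in> space M. fiber_prob (wrd T q (n + k)) z
      > exp (- (real n * (?h - \<eta>))) * fiber_prob (wrd T q k) ((T ^^ n) z)}"
    have "?E \<subseteq> ?B \<union> ?D"
    proof (rule subsetI, rule ccontr)
      fix z assume z: "z \<in> ?E" and "z \<notin> ?B \<union> ?D"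
      then have zs: "z \<in> space M" and b: "(?h - 3 * \<eta> / 4) * real n < birkhoff_sum T (?g K) n z"
        and d: "d z < real n * (\<eta> / 8)" by auto
      let ?p = "fiber_prob (wrd T q (n + k)) z" and ?r = "fiber_prob (wrd T q k) ((T ^^ n) z)"
      have E: "?p > exp (- (real n * (?h - \<eta>))) * ?r" using z by simp
      have "0 \<le> exp (- (real n * (?h - \<eta>))) * ?r" by (simp add: fiber_prob_def)
      then have p: "0 < ?p" using E by linarith
      note S = sum_trunc_info_le[OF q zs p, of L]
      have "birkhoff_sum T (?g K) n z - d z \<le> (\<Sum>j<n. ?g (n + k - 1 - j) ((T ^^ j) z))"
        unfolding birkhoff_sum_def d_def sum_subtractf[symmetric] by (intro sum_mono) auto
      with S b d have "(?h - 3 * \<eta> / 4) * real n - real n * (\<eta> / 8) < ln ?r - ln ?p" by linarith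
      then have "real n * (?h - \<eta>) < ln ?r - ln ?p"
      proof -
        have "(?h - 3 * \<eta> / 4) * real n - real n * (\<eta> / 8) = real n * (?h - \<eta>) + real n * (\<eta> / 8)"
          by (simp add: algebra_simps)
        moreover have "0 \<le> real n * (\<eta> / 8)" using \<eta> by simp
        ultimately show ?thesis
          using \<open>(?h - 3 * \<eta> / 4) * real n - real n * (\<eta> / 8) < ln ?r - ln ?p\<close> by linarith
      qed
      moreover have "ln ?p > - (real n * (?h - \<eta>)) + ln ?r"
      proof -
        have "ln (exp (- (real n * (?h - \<eta>))) * ?r) < ln ?p"
          using E p S by (subst ln_less_cancel_iff) auto
        then show ?thesis using S by (simp add: ln_mult)
      qed
      ultimately show False by linarith
    qed
    moreover have BD: "?B \<in> sets M" "?D \<in> sets M" by measurable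
    ultimately have "prob ?E \<le> prob (?B \<union> ?D)" by (intro finite_measure_mono) auto
    also have "\<dots> \<le> prob ?B + prob ?D" by (rule measure_Un_le[OF BD])
    also have "\<dots> \<le> e" using N0[of n] n D by simp
    finally show "prob ?E \<le> e" .
  qed
qed

end

section \<open>Regularity and Hamming balls\<close>

text \<open>Inner and outer approximation are proved together since complements exchange them;
  compactness of the space makes the complement of an open set in it compact. \<open>U\<close> is
  open in the whole type, so only its trace on the space is measured.\<close>

lemma compact_regular:
  fixes M :: "'a::metric_space measure"
  assumes M: "finite_measure M" and X: "compact (space M)" and sets_M: "sets M = sets (restrict_space borel (space M))"
    and B: "B \<in> sets borel" and e: "0 < e"
  shows "\<exists>K U. compact K \<and> open U \<and> K \<subseteq> space M \<inter> B \<and> B \<inter> space M \<subseteq> U \<and> measure M (space M \<inter> U - K) < e"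
proof -
  interpret finite_measure M by (rule M)
  let ?X = "space M"
  have borelM: "?X \<inter> S \<in> sets M" if "S \<in> sets borel" for S
    unfolding sets_M sets_restrict_space using that by (rule imageI)
  have openM: "?X \<inter> S \<in> sets M" if "open S" for S by (rule borelM[OF borel_open[OF that]])
  have compactM: "S \<in> sets M" if "compact S" "S \<subseteq> ?X" for S
  proof -
    have "?X \<inter> S \<in> sets M" by (rule borelM) (use compact_imp_closed[OF that(1)] in auto)
    then show ?thesis using that by (simp add: Int_absorb1)
  qed
  have "B \<in> sigma_sets UNIV (Collect open)" using B unfolding borel_def by simp
  then show ?thesis using e
  proof (induction arbitrary: e)
    case (Basic S)
    then have S: "open S" by simp
    show ?case
    \<comment> \<open>The distance \<open>infdist\<close> to the empty set is 0, so the exhaustion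
      by distance to the complement needs a separate case.\<close>
    proof (cases "?X - S = {}")
      case True
      moreover have "?X \<inter> S - ?X = {}" by auto
      then have "measure M (?X \<inter> S - ?X) = 0" by (simp only: measure_empty)
      ultimately show ?thesis using X S Basic.prems by - (rule exI[of _ ?X], rule exI[of _ S], auto)
    next
      case False
      have cl: "closed (?X - S)" using compact_imp_closed[OF X] S by (simp add: closed_Diff)
      define K where "K n = ?X \<inter> {x. 1 / real (Suc n) \<le> infdist x (?X - S)}" for n
      have "closed {x. 1 / real (Suc n) \<le> infdist x (?X - S)}" for n
        by (intro closed_Collect_le continuous_intros)
      then have K: "compact (K n)" for n unfolding K_def by (rule compact_Int_closed[OF X])
      have KS: "K n \<subseteq> ?X \<inter> S" for n
      proof
        fix x assume x: "x \<in> K n"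
        have "x \<in> S"
        proof (rule ccontr)
          assume "x \<notin> S"
          then have "infdist x (?X - S) = 0" using x by (auto simp: K_def)
          then show False using x by (simp add: K_def)
        qed
        then show "x \<in> ?X \<inter> S" using x by (simp add: K_def)
      qed
      have Km: "K n \<in> sets M" for n using compactM[OF K] by (simp add: K_def)
      have "incseq K"
      proof (rule incseq_SucI)
        fix n show "K n \<le> K (Suc n)"
        proof
          fix x assume x: "x \<in> K n"
          have "1 / real (Suc (Suc n)) \<le> 1 / real (Suc n)" by (simp add: field_simps)
          with x show "x \<in> K (Suc n)" unfolding K_def by fastforce
        qed
      qed
      moreover have "(\<Union>n. K n) = ?X \<inter> S"
      proof (intro equalityI subsetI)
        fix x assume x: "x \<in> ?X \<inter> S"
        then have "infdist x (?X - S) > 0"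
          using in_closed_iff_infdist_zero[OF cl False, of x] infdist_nonneg[of x "?X - S"]
          by (auto simp: less_le)
        then obtain n where "1 / real (Suc n) < infdist x (?X - S)"
          using nat_approx_posE by blast
        then show "x \<in> (\<Union>n. K n)" using x unfolding K_def by (auto intro!: exI[of _ n])
      qed (use KS in auto)
      ultimately have lim: "(\<lambda>n. measure M (K n)) \<longlonglongrightarrow> measure M (?X \<inter> S)"
        using finite_Lim_measure_incseq[of K] Km by auto
      have "measure M (?X \<inter> S) - e < measure M (?X \<inter> S)" using Basic by simp
      from order_tendstoD(1)[OF lim this]
      obtain n where "measure M (?X \<inter> S) - e < measure M (K n)"
        unfolding eventually_sequentially by auto
      then have "measure M (?X \<inter> S - K n) < e"
        using finite_measure_Diff[OF openM[OF S] Km KS] by simp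
      then show ?thesis using K[of n] S KS[of n] by - (rule exI[of _ "K n"], rule exI[of _ S], auto)
    qed
  next
    case Empty
    show ?case by (intro exI[of _ "{}"]) (use Empty in auto)
  next
    case (Compl S)
    obtain K U where KU: "compact K" "open U" "K \<subseteq> ?X \<inter> S" "S \<inter> ?X \<subseteq> U"
      "measure M (?X \<inter> U - K) < e" using Compl.IH[OF Compl.prems] by blast
    have "?X \<inter> - K - (?X - U) = ?X \<inter> U - K" by auto
    then show ?case
      using KU X compact_imp_closed[OF KU(1)]
      by - (rule exI[of _ "?X - U"], rule exI[of _ "- K"], auto simp: compact_diff open_Compl)
  next
    case (Union A)
    \<comment> \<open>The individual errors add up to e / 2. The other half pays for cutting the
      union of the compact sets to finitely many, as an infinite union need not be compact.\<close>
    define Q where "Q i K U \<longleftrightarrow> compact K \<and> open U \<and> K \<subseteq> ?X \<inter> A i \<and> A i \<inter> ?X \<subseteq> U \<and>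
        measure M (?X \<inter> U - K) < e * (1/2) ^ Suc (Suc i)" for i K U
    have "\<exists>K U. Q i K U" for i
      unfolding Q_def by (rule Union.IH) (use Union.prems in simp)
    then obtain K U where Q: "\<And>i. Q i (K i) (U i)" by metis
    have KU: "\<And>i. compact (K i)" "\<And>i. open (U i)" "\<And>i. K i \<subseteq> ?X \<inter> A i"
      "\<And>i. A i \<inter> ?X \<subseteq> U i" "\<And>i. measure M (?X \<inter> U i - K i) < e * (1/2) ^ Suc (Suc i)"
      using Q unfolding Q_def by blast+
    have Km: "K i \<in> sets M" for i using compactM[OF KU(1)] KU(3) by auto
    have Um: "?X \<inter> U i \<in> sets M" for i by (rule openM[OF KU(2)])
    let ?L = "\<lambda>n. \<Union>i<n. K i"
    have "incseq ?L" by (intro incseq_SucI UN_mono) auto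
    then have "(\<lambda>n. measure M (?L n)) \<longlonglongrightarrow> measure M (\<Union>n. ?L n)"
      using Km by (intro finite_Lim_measure_incseq) auto
    moreover have "(\<Union>n. ?L n) = (\<Union>i. K i)" by auto
    ultimately have lim: "(\<lambda>n. measure M (?L n)) \<longlonglongrightarrow> measure M (\<Union>i. K i)" by simp
    have "measure M (\<Union>i. K i) - e / 2 < measure M (\<Union>i. K i)" using Union by simp
    from order_tendstoD(1)[OF lim this]
    obtain n where n: "measure M (\<Union>i. K i) - e / 2 < measure M (?L n)"
      unfolding eventually_sequentially by auto
    have Lm: "?L n \<in> sets M" "(\<Union>i. K i) \<in> sets M" using Km by auto
    have sums: "(\<lambda>i. e * (1/2) ^ Suc (Suc i)) sums (e / 2)"
      using sums_mult[OF geometric_sums[of "1/2::real"], of "e / 4"] by simp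
    have summable: "summable (\<lambda>i. measure M (?X \<inter> U i - K i))"
    proof (rule summable_comparison_test'[OF sums_summable[OF sums]])
      show "norm (measure M (?X \<inter> U i - K i)) \<le> e * (1/2) ^ Suc (Suc i)" for i
        using KU(5)[of i] by simp
    qed
    have "measure M (\<Union>i. ?X \<inter> U i - K i) \<le> (\<Sum>i. measure M (?X \<inter> U i - K i))"
      using Um Km by (intro finite_measure_subadditive_countably summable) auto
    also have "\<dots> \<le> (\<Sum>i. e * (1/2) ^ Suc (Suc i))"
      by (intro suminf_le summable sums_summable[OF sums] less_imp_le KU(5))
    also have "\<dots> = e / 2" using sums by (simp add: sums_unique[symmetric])
    finally have 1: "measure M (\<Union>i. ?X \<inter> U i - K i) \<le> e / 2" .
    have 2: "measure M ((\<Union>i. K i) - ?L n) < e / 2"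
      using n by (subst finite_measure_Diff) (use Lm in auto)
    have "measure M (?X \<inter> (\<Union>i. U i) - ?L n) \<le> measure M ((\<Union>i. ?X \<inter> U i - K i) \<union> ((\<Union>i. K i) - ?L n))"
      by (rule finite_measure_mono) (use Um Km Lm in auto)
    also have "\<dots> \<le> measure M (\<Union>i. ?X \<inter> U i - K i) + measure M ((\<Union>i. K i) - ?L n)"
      by (rule measure_Un_le) (use Um Km Lm in auto)
    also have "\<dots> < e" using 1 2 by simp
    finally have "measure M (?X \<inter> (\<Union>i. U i) - ?L n) < e" .
    moreover have "compact (?L n)" using KU(1) by (intro compact_UN) auto
    moreover have "open (\<Union>i. U i)" using KU(2) by auto
    moreover have "?L n \<subseteq> ?X \<inter> (\<Union>i. A i)" using KU(3) by blast
    moreover have "(\<Union>i. A i) \<inter> ?X \<subseteq> (\<Union>i. U i)" using KU(4) by blast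
    ultimately show ?case by blast
  qed
qed

text \<open>In the manner of Lusin's theorem: each fiber is filled by a compact set up to small
  measure, finitely many disjoint compact sets have positive mutual distances, and \<open>V\<close>
  is what remains. This takes the place of a partition with null boundaries.\<close>

lemma simple_function_locally_constant:
  fixes M :: "'a::metric_space measure"
  assumes M: "prob_space M" and X: "compact (space M)" and sets_M: "sets M = sets (restrict_space borel (space M))"
    and q: "simple_function M q" and e: "0 < e"
  shows "\<exists>V d. V \<in> sets M \<and> measure M V < e \<and> 0 < d \<and>
    (\<forall>y\<in>space M - V. \<forall>z\<in>space M - V. dist y z \<le> d \<longrightarrow> q y = q z)"
proof -
  interpret prob_space M by (rule M)
  let ?V = "q ` space M" and ?A = "\<lambda>v. {y \<in> space M. q y = v}"
  have fin: "finite ?V" by (rule simple_functionD(1)[OF q])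
  have A: "?A v \<in> sets M" for v by (rule simple_function_fiber_sets[OF q])
  define e' where "e' = e / (1 + real (card ?V))"
  have e': "0 < e'" using e by (simp add: e'_def add_pos_nonneg)
  define Q where "Q v K \<longleftrightarrow> compact K \<and> K \<subseteq> ?A v \<and> prob (?A v - K) < e'" for v K
  have "\<exists>K. Q v K" for v
  proof -
    obtain B where B: "B \<in> sets borel" "?A v = space M \<inter> B"
      using A[of v] unfolding sets_M sets_restrict_space by blast
    obtain K U where KU: "compact K" "open U" "K \<subseteq> ?A v" "?A v \<subseteq> U" "prob (space M \<inter> U - K) < e'"
      using compact_regular[OF finite_measure_axioms X sets_M B(1) e'] B(2) by (auto simp: Int_commute)
    have "space M \<inter> U \<in> sets M" "space M \<inter> K \<in> sets M"
      unfolding sets_M sets_restrict_space using KU(2) compact_imp_closed[OF KU(1)] by auto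
    moreover have "space M \<inter> K = K" using KU(3) by auto
    ultimately have "space M \<inter> U - K \<in> sets M" by auto
    then have "prob (?A v - K) \<le> prob (space M \<inter> U - K)"
      by (rule finite_measure_mono[rotated]) (use KU in auto)
    then show ?thesis unfolding Q_def using KU by (intro exI[of _ K]) auto
  qed
  then obtain K where Q: "\<And>v. Q v (K v)" by metis
  have K: "\<And>v. compact (K v)" "\<And>v. K v \<subseteq> ?A v" "\<And>v. prob (?A v - K v) < e'"
    using Q unfolding Q_def by blast+
  have Km: "K v \<in> sets M" for v
  proof -
    have "space M \<inter> K v \<in> sets M"
      unfolding sets_M sets_restrict_space using compact_imp_closed[OF K(1)[of v]] by auto
    moreover have "space M \<inter> K v = K v" using K(2)[of v] by auto
    ultimately show ?thesis by simp
  qed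
  define V where "V = (\<Union>v\<in>?V. ?A v - K v)"
  have Vm: "V \<in> sets M" unfolding V_def using fin A Km by (intro sets.finite_UN) auto
  have "prob V \<le> (\<Sum>v\<in>?V. prob (?A v - K v))"
    unfolding V_def using fin A Km by (intro finite_measure_subadditive_finite) auto
  also have "\<dots> \<le> (\<Sum>v\<in>?V. e')" by (intro sum_mono less_imp_le K)
  also have "\<dots> = e * (real (card ?V) / (1 + real (card ?V)))" by (simp add: e'_def)
  also have "\<dots> < e * 1" using e by (intro mult_strict_left_mono) auto
  finally have pV: "prob V < e" by simp
  have "\<exists>d>0. \<forall>y\<in>K v. \<forall>z\<in>K w. v \<noteq> w \<longrightarrow> d \<le> dist y z" for v w
  proof (cases "v = w")
    case True
    then show ?thesis by (intro exI[of _ 1]) auto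
  next
    case False
    then have "K v \<inter> K w = {}" using K(2)[of v] K(2)[of w] by auto
    show ?thesis
    proof (cases "K v = {} \<or> K w = {}")
      case True
      then show ?thesis by (intro exI[of _ 1]) auto
    next
      case ne: False
      have "continuous_on (K v) (\<lambda>x. infdist x (K w))" by (intro continuous_intros)
      then obtain x0 where x0: "x0 \<in> K v" "\<forall>y\<in>K v. infdist x0 (K w) \<le> infdist y (K w)"
        using continuous_attains_inf[OF K(1)[of v]] ne by blast
      have "infdist x0 (K w) \<noteq> 0"
        using x0(1) \<open>K v \<inter> K w = {}\<close> ne in_closed_iff_infdist_zero[OF compact_imp_closed[OF K(1)], of w x0]
        by blast
      then have "0 < infdist x0 (K w)" using infdist_nonneg[of x0 "K w"] by linarith
      moreover have "infdist x0 (K w) \<le> dist y z" if "y \<in> K v" "z \<in> K w" for y z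
        using x0(2) that infdist_le[of z "K w" y] by (meson order_trans)
      ultimately show ?thesis by blast
    qed
  qed
  then obtain D where D: "\<And>v w. 0 < D v w"
    "\<And>v w y z. y \<in> K v \<Longrightarrow> z \<in> K w \<Longrightarrow> v \<noteq> w \<Longrightarrow> D v w \<le> dist y z" by metis
  \<comment> \<open>Halving makes \<open>d\<close> strictly smaller than every relevant distance
    bound, so that \<open>dist y z \<le> d\<close> is contradictory; the 1 keeps the minimum over a
    nonempty set.\<close>
  define d where "d = Min (insert 1 ((\<lambda>(v, w). D v w) ` (?V \<times> ?V))) / 2"
  have f: "finite (insert 1 ((\<lambda>(v, w). D v w) ` (?V \<times> ?V)))" using fin by auto
  have d: "0 < d" unfolding d_def using D(1) f by (subst half_gt_zero_iff, subst Min_gr_iff) auto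
  have dD: "d < D v w" if "v \<in> ?V" "w \<in> ?V" for v w
  proof -
    have "D v w \<in> insert 1 ((\<lambda>(v, w). D v w) ` (?V \<times> ?V))" using that by (auto intro!: image_eqI[of _ _ "(v, w)"])
    from Min_le[OF f this] have "2 * d \<le> D v w" by (simp add: d_def)
    then show ?thesis using d by simp
  qed
  have "q y = q z" if "y \<in> space M - V" "z \<in> space M - V" "dist y z \<le> d" for y z
  proof (rule ccontr)
    assume ne: "q y \<noteq> q z"
    have "y \<in> K (q y)" "z \<in> K (q z)" using that by (auto simp: V_def)
    from D(2)[OF this ne] dD[of "q y" "q z"] that show False by auto
  qed
  then show ?thesis using Vm pV d by blast
qed

text \<open>Meaningful for lists of equal length only: otherwise \<open>hd []\<close> enters.\<close>

primrec hamming :: "'b list \<Rightarrow> 'b list \<Rightarrow> nat" where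
  "hamming [] v = 0"
| "hamming (a # u) v = (if a = hd v then 0 else 1) + hamming u (tl v)"

text \<open>A generating function instead of binomial estimates: the sum factorises over positions,
  and at each position at most one letter agrees while at most card A letters have weight t.\<close>

lemma hamming_weight_sum:
  fixes t :: real
  assumes "finite A" "0 \<le> t"
  shows "(\<Sum>v | set v \<subseteq> A \<and> length v = length u. t ^ hamming u v) \<le> (1 + real (card A) * t) ^ length u"
proof (induction u)
  case Nil
  have "{v. set v \<subseteq> A \<and> length v = length []} = {[]}" by auto
  then show ?case by simp
next
  case (Cons a u)
  let ?L = "{v. set v \<subseteq> A \<and> length v = length u}"
  have fin: "finite ?L" using assms(1) by (rule finite_lists_length_eq)
  have eq: "{v. set v \<subseteq> A \<and> length v = length (a # u)} = (\<lambda>(b, v). b # v) ` (A \<times> ?L)"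
    by (auto simp: image_iff length_Suc_conv)
  have "(\<Sum>v | set v \<subseteq> A \<and> length v = length (a # u). t ^ hamming (a # u) v)
      = (\<Sum>(b, v)\<in>A \<times> ?L. (if a = b then 1 else t) * t ^ hamming u v)"
    unfolding eq by (subst sum.reindex) (auto simp: inj_on_def intro!: sum.cong)
  also have "\<dots> = (\<Sum>b\<in>A. if a = b then 1 else t) * (\<Sum>v\<in>?L. t ^ hamming u v)"
    by (simp add: sum_product sum.cartesian_product)
  also have "\<dots> \<le> (1 + real (card A) * t) * (1 + real (card A) * t) ^ length u"
  proof (rule mult_mono[OF _ Cons.IH])
    have "(\<Sum>b\<in>A. if a = b then 1 else t) \<le> (\<Sum>b\<in>A. (if a = b then 1 else 0) + t)"
      using assms(2) by (intro sum_mono) auto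
    also have "\<dots> \<le> 1 + real (card A) * t"
      using assms(1) by (simp add: sum.distrib)
    finally show "(\<Sum>b\<in>A. if a = b then 1 else t) \<le> 1 + real (card A) * t" .
  qed (use assms in \<open>auto intro!: sum_nonneg\<close>)
  finally show ?case by simp
qed

text \<open>Chernoff's trick: as t \<le> 1, every word of the ball has weight at least t to the
  power s in the generating function.\<close>

lemma card_hamming_ball:
  fixes t s :: real
  assumes A: "finite A" and t: "0 < t" "t \<le> 1"
  shows "real (card {v. set v \<subseteq> A \<and> length v = length u \<and> real (hamming u v) \<le> s}) * t powr s
    \<le> (1 + real (card A) * t) ^ length u"
proof -
  let ?B = "{v. set v \<subseteq> A \<and> length v = length u \<and> real (hamming u v) \<le> s}"
  have "real (card ?B) * t powr s = (\<Sum>v\<in>?B. t powr s)" by simp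
  also have "\<dots> \<le> (\<Sum>v\<in>?B. t ^ hamming u v)"
  proof (rule sum_mono)
    fix v assume "v \<in> ?B"
    then have "t powr s \<le> t powr real (hamming u v)" using t by (intro powr_mono') auto
    then show "t powr s \<le> t ^ hamming u v" using t by (simp add: powr_realpow)
  qed
  also have "\<dots> \<le> (\<Sum>v | set v \<subseteq> A \<and> length v = length u. t ^ hamming u v)"
    using t finite_lists_length_eq[OF A] by (intro sum_mono2) auto
  also have "\<dots> \<le> (1 + real (card A) * t) ^ length u"
    using A t by (intro hamming_weight_sum) auto
  finally show ?thesis .
qed

lemma hamming_ball_subexponential:
  assumes A: "finite A" and \<kappa>: "0 < \<kappa>"
  shows "\<exists>\<theta>>0. \<forall>u. real (card {v. set v \<subseteq> A \<and> length v = length u \<and>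
    real (hamming u v) \<le> \<theta> * real (length u)}) \<le> exp (\<kappa> * real (length u))"
proof -
  define a where "a = real (card A)"
  \<comment> \<open>The choice of \<open>t\<close> makes (1 + a t)^n at most exp (\<kappa> n / 2),
    and that of \<theta> makes t to the power - \<theta> n at most the same. Since t = 1 is
    possible, the denominator of \<theta> uses 1 - ln t rather than - ln t.\<close>
  define t where "t = min 1 (\<kappa> / (2 * (a + 1)))"
  define \<theta> where "\<theta> = \<kappa> / (2 * (1 - ln t))"
  have a: "0 \<le> a" by (simp add: a_def)
  have t: "0 < t" "t \<le> 1" using \<kappa> a by (auto simp: t_def)
  have lt: "ln t \<le> 0" using t by simp
  have \<theta>: "0 < \<theta>" using \<kappa> lt by (simp add: \<theta>_def)
  have at: "a * t \<le> \<kappa> / 2"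
  proof -
    have "a * t \<le> a * (\<kappa> / (2 * (a + 1)))" using a by (intro mult_left_mono) (auto simp: t_def)
    also have "\<dots> = \<kappa> / 2 * (a / (a + 1))" by simp
    also have "\<dots> \<le> \<kappa> / 2 * 1" using \<kappa> a by (intro mult_left_mono) auto
    finally show ?thesis by simp
  qed
  have tl: "- (\<theta> * ln t) \<le> \<kappa> / 2"
  proof -
    have "- (\<theta> * ln t) = \<kappa> / 2 * (- ln t / (1 - ln t))" by (simp add: \<theta>_def)
    also have "\<dots> \<le> \<kappa> / 2 * 1"
    proof (rule mult_left_mono)
      show "- ln t / (1 - ln t) \<le> 1" using lt by (subst divide_le_eq_1_pos) auto
    qed (use \<kappa> in simp)
    finally show ?thesis by simp
  qed
  have "real (card {v. set v \<subseteq> A \<and> length v = length u \<and>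
    real (hamming u v) \<le> \<theta> * real (length u)}) \<le> exp (\<kappa> * real (length u))" for u :: "'a list"
  proof -
    let ?n = "real (length u)"
    let ?c = "real (card {v. set v \<subseteq> A \<and> length v = length u \<and> real (hamming u v) \<le> \<theta> * ?n})"
    have "?c * exp (\<theta> * ?n * ln t) \<le> (1 + a * t) ^ length u"
      using card_hamming_ball[OF A t, of u "\<theta> * ?n"] t by (simp add: powr_def a_def)
    also have "\<dots> \<le> exp (a * t) ^ length u" using a t by (intro power_mono) auto
    also have "\<dots> = exp (?n * (a * t))" by (simp add: exp_of_nat_mult)
    finally have "?c \<le> exp (?n * (a * t)) / exp (\<theta> * ?n * ln t)" by (simp add: le_divide_eq)
    also have "\<dots> = exp (?n * (a * t - \<theta> * ln t))" by (simp add: exp_diff[symmetric] algebra_simps)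
    also have "\<dots> \<le> exp (\<kappa> * ?n)"
    proof -
      have "a * t - \<theta> * ln t \<le> \<kappa>" using at tl by linarith
      from mult_left_mono[OF this, of ?n] show ?thesis by (simp add: mult.commute)
    qed
    finally show ?thesis .
  qed
  with \<theta> show ?thesis by blast
qed

text \<open>The words of two close orbits can differ at time i only if one of the orbits is in
  \<open>V\<close> at that time.\<close>

lemma hamming_wrd_le_birkhoff_sum:
  fixes T :: "'a::metric_space \<Rightarrow> 'a"
  assumes loc: "\<And>y z. y \<in> X - V \<Longrightarrow> z \<in> X - V \<Longrightarrow> dist y z \<le> d \<Longrightarrow> q y = q z"
    and TX: "\<And>x. x \<in> X \<Longrightarrow> T x \<in> X"
    and "y \<in> X" "z \<in> X" "\<And>i. i < n \<Longrightarrow> dist ((T ^^ i) y) ((T ^^ i) z) \<le> d"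
  shows "real (hamming (wrd T q n y) (wrd T q n z))
    \<le> birkhoff_sum T (indicator V) n y + birkhoff_sum T (indicator V) n z"
  using assms(3-)
proof (induction n arbitrary: y z)
  case 0
  then show ?case by (simp add: birkhoff_sum_def)
next
  case (Suc n)
  have "real (hamming (wrd T q n (T y)) (wrd T q n (T z)))
    \<le> birkhoff_sum T (indicator V) n (T y) + birkhoff_sum T (indicator V) n (T z)"
  proof (rule Suc.IH)
    fix i assume "i < n"
    then show "dist ((T ^^ i) (T y)) ((T ^^ i) (T z)) \<le> d"
      using Suc.prems(3)[of "Suc i"] by (simp add: funpow_swap1)
  qed (use Suc.prems TX in auto)
  moreover have "(if q y = q z then 0 else 1) \<le> indicator V y + (indicator V z :: real)"
    using loc[of y z] Suc.prems(1,2) Suc.prems(3)[of 0] by (auto simp: indicator_def)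
  moreover have "real (hamming (wrd T q (Suc n) y) (wrd T q (Suc n) z))
    = (if q y = q z then 0 else 1) + real (hamming (wrd T q n (T y)) (wrd T q n (T z)))" by simp
  ultimately show ?case unfolding birkhoff_sum_Suc by linarith
qed

section \<open>Separated sets\<close>

text \<open>For n = 0 the Bowen distance is the maximum of the empty set, an unspecified value;
  hence the condition \<open>0 < n\<close> here and below.\<close>

lemma bowen_dist_less_iff:
  "0 < n \<Longrightarrow> \<delta> < bowen_dist T n x y \<longleftrightarrow> (\<exists>i<n. \<delta> < dist ((T ^^ i) x) ((T ^^ i) y))"
  unfolding bowen_dist_def by (subst Max_gr_iff) auto

lemma separatedD:
  assumes "separated T n \<delta> K E" "0 < n" "x \<in> E" "y \<in> E" "x \<noteq> y"
  shows "\<exists>i<n. \<delta> < dist ((T ^^ i) x) ((T ^^ i) y)"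
proof -
  have "\<forall>x\<in>E. \<forall>y\<in>E. x \<noteq> y \<longrightarrow> \<delta> < bowen_dist T n x y"
    using assms(1) unfolding separated_def by (rule conjunct2)
  from this[rule_format, OF assms(3-5)] have "\<delta> < bowen_dist T n x y" .
  then show ?thesis using bowen_dist_less_iff[OF assms(2)] by blast
qed

lemma bowen_dist_commute: "bowen_dist T n x y = bowen_dist T n y x"
  by (simp add: bowen_dist_def dist_commute)

lemma separated_subset: "separated T n \<delta> K E \<Longrightarrow> K \<subseteq> K' \<Longrightarrow> separated T n \<delta> K' E"
  by (auto simp: separated_def)

locale compact_system =
  fixes X :: "'a::metric_space set" and T :: "'a \<Rightarrow> 'a"
  assumes compact_X: "compact X" and T_cont: "continuous_on X T" and T_image: "T ` X = X"
begin

lemma funpow_image: "(T ^^ n) ` X = X"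
proof (induction n)
  case (Suc n)
  have "(T ^^ Suc n) ` X = T ` ((T ^^ n) ` X)" by (simp add: image_comp)
  then show ?case by (simp only: Suc T_image)
qed simp

lemma funpow_in: "x \<in> X \<Longrightarrow> (T ^^ n) x \<in> X"
  using funpow_image by blast

lemma funpow_cont: "continuous_on X (T ^^ n)"
proof (induction n)
  case (Suc n)
  show ?case
    using continuous_on_compose[OF Suc] T_cont by (simp add: funpow_image)
qed (simp add: continuous_on_id id_def)

lemma birkhoff_sum_cont:
  "continuous_on X f \<Longrightarrow> continuous_on X (birkhoff_sum T f n)"
  unfolding birkhoff_sum_def
  by (intro continuous_on_sum, rule continuous_on_compose2[OF _ funpow_cont]) (auto simp: funpow_image)

lemma funpow_uniform:
  assumes "0 < \<delta>"
  shows "\<exists>r>0. \<forall>y\<in>X. \<forall>z\<in>X. dist y z < r \<longrightarrow> (\<forall>i<n. dist ((T ^^ i) y) ((T ^^ i) z) < \<delta>)"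
proof -
  have "uniformly_continuous_on X (T ^^ i)" for i
    by (rule compact_uniformly_continuous[OF funpow_cont compact_X])
  then have "\<forall>i. \<exists>r>0. \<forall>y\<in>X. \<forall>z\<in>X. dist z y < r \<longrightarrow> dist ((T ^^ i) z) ((T ^^ i) y) < \<delta>"
    unfolding uniformly_continuous_on_def using assms by blast
  from choice[OF this] obtain r where r: "\<And>i. 0 < r i"
    "\<And>i y z. y \<in> X \<Longrightarrow> z \<in> X \<Longrightarrow> dist y z < r i \<Longrightarrow> dist ((T ^^ i) y) ((T ^^ i) z) < \<delta>"
    by blast
  define r0 where "r0 = Min (insert 1 (r ` {..<n}))"
  have "0 < r0" unfolding r0_def using r(1) by (subst Min_gr_iff) auto
  moreover have "r0 \<le> r i" if "i < n" for i
    unfolding r0_def using that by (intro Min_le) auto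
  ultimately show ?thesis using r(2) by (meson order_less_le_trans)
qed

text \<open>A ball of radius r / 2 holds at most one point of a separated set. A bound common to all
  separated sets makes the real supremum in \<open>Pn\<close> meaningful and yields separated sets
  of greatest cardinality.\<close>

lemma separated_card_bound:
  assumes n: "0 < n" and \<delta>: "0 < \<delta>"
  shows "\<exists>N. \<forall>E. separated T n \<delta> X E \<longrightarrow> finite E \<and> card E \<le> N"
proof -
  obtain r where r: "0 < r"
    "\<And>y z i. y \<in> X \<Longrightarrow> z \<in> X \<Longrightarrow> dist y z < r \<Longrightarrow> i < n \<Longrightarrow> dist ((T ^^ i) y) ((T ^^ i) z) < \<delta>"
    using funpow_uniform[OF \<delta>, of n] by blast
  obtain k where k: "finite k" "X \<subseteq> (\<Union>x\<in>k. ball x (r / 2))"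
  proof (rule compactE_image[OF compact_X, of X "\<lambda>x. ball x (r / 2)"])
    show "X \<subseteq> (\<Union>x\<in>X. ball x (r / 2))" using r(1) by auto
  qed auto
  have "finite E \<and> card E \<le> card k" if E: "separated T n \<delta> X E" for E
  proof -
    have "\<forall>y\<in>E. \<exists>c\<in>k. dist c y < r / 2"
      using E k(2) unfolding separated_def by (auto simp: subset_iff)
    then obtain c where c: "\<And>y. y \<in> E \<Longrightarrow> c y \<in> k" "\<And>y. y \<in> E \<Longrightarrow> dist (c y) y < r / 2" by metis
    have "inj_on c E"
    proof (rule inj_onI, rule ccontr)
      fix y z assume yz: "y \<in> E" "z \<in> E" "c y = c z" "y \<noteq> z"
      then have "dist y z < r" using c(2)[of y] c(2)[of z] dist_triangle2[of y z "c y"]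
        by (simp add: dist_commute)
      moreover have "y \<in> X" "z \<in> X" using yz E unfolding separated_def by auto
      moreover obtain i where "i < n" "\<delta> < dist ((T ^^ i) y) ((T ^^ i) z)"
        using separatedD[OF E n yz(1,2,4)] by blast
      ultimately show False using r(2)[of y z i] by simp
    qed
    moreover have "c ` E \<subseteq> k" using c(1) by blast
    ultimately show ?thesis using k(1) card_inj_on_le inj_on_finite by blast
  qed
  then show ?thesis by blast
qed

lemma Pn_bdd_above:
  assumes n: "0 < n" and \<delta>: "0 < \<delta>" and f: "continuous_on X f" and K: "K \<subseteq> X"
  shows "bdd_above {(\<Sum>x\<in>E. exp (birkhoff_sum T f n x)) | E. finite E \<and> separated T n \<delta> K E}"
proof -
  obtain N where N: "\<And>E. separated T n \<delta> X E \<Longrightarrow> card E \<le> N"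
    using separated_card_bound[OF n \<delta>] by blast
  have "bounded (birkhoff_sum T f n ` X)"
    by (intro compact_imp_bounded compact_continuous_image birkhoff_sum_cont f compact_X)
  then obtain B where B: "\<And>x. x \<in> X \<Longrightarrow> \<bar>birkhoff_sum T f n x\<bar> \<le> B"
    unfolding bounded_iff by auto
  have "(\<Sum>x\<in>E. exp (birkhoff_sum T f n x)) \<le> real N * exp B" if "separated T n \<delta> K E" for E
  proof -
    have "E \<subseteq> X" using that K unfolding separated_def by blast
    then have "(\<Sum>x\<in>E. exp (birkhoff_sum T f n x)) \<le> (\<Sum>x\<in>E. exp B)"
      using B by (intro sum_mono) (auto simp: abs_le_iff)
    also have "\<dots> \<le> real N * exp B" using N[OF separated_subset[OF that K]] by simp
    finally show ?thesis .
  qed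
  then show ?thesis by (intro bdd_aboveI) auto
qed

lemma Pn_upper:
  assumes "0 < n" "0 < \<delta>" "continuous_on X f" "K \<subseteq> X" "finite E" "separated T n \<delta> K E"
  shows "(\<Sum>x\<in>E. exp (birkhoff_sum T f n x)) \<le> Pn T f n \<delta> K"
  unfolding Pn_def using assms by (intro cSup_upper Pn_bdd_above) auto

lemma Pn_least:
  assumes "\<And>E. finite E \<Longrightarrow> separated T n \<delta> K E \<Longrightarrow> (\<Sum>x\<in>E. exp (birkhoff_sum T f n x)) \<le> c"
  shows "Pn T f n \<delta> K \<le> c"
  unfolding Pn_def
proof (rule cSup_least)
  have "separated T n \<delta> K {}" by (simp add: separated_def)
  then show "{(\<Sum>x\<in>E. exp (birkhoff_sum T f n x)) | E. finite E \<and> separated T n \<delta> K E} \<noteq> {}"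
    by blast
qed (use assms in auto)

lemma Pn_mono:
  assumes "0 < n" "0 < \<delta>" "\<delta> \<le> \<delta>'" "continuous_on X f" "K \<subseteq> X" "K' \<subseteq> K"
  shows "Pn T f n \<delta>' K' \<le> Pn T f n \<delta> K"
proof (rule Pn_least)
  fix E assume E: "finite E" "separated T n \<delta>' K' E"
  have "separated T n \<delta> K E" using E(2) assms(3,6) unfolding separated_def by fastforce
  then show "(\<Sum>x\<in>E. exp (birkhoff_sum T f n x)) \<le> Pn T f n \<delta> K"
    using E(1) assms by (intro Pn_upper) auto
qed

lemma Pn_pos:
  assumes "0 < n" "0 < \<delta>" "continuous_on X f" "K \<subseteq> X" "K \<noteq> {}"
  shows "0 < Pn T f n \<delta> K"
proof -
  obtain y where y: "y \<in> K" using assms(5) by blast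
  have "(\<Sum>x\<in>{y}. exp (birkhoff_sum T f n x)) \<le> Pn T f n \<delta> K"
    using assms y by (intro Pn_upper) (auto simp: separated_def)
  then have "exp (birkhoff_sum T f n y) \<le> Pn T f n \<delta> K" by simp
  then show ?thesis by (rule less_le_trans[OF exp_gt_zero])
qed

text \<open>Surjectivity of T gives a preimage of x itself. Nonemptiness makes \<open>Pn\<close>
  positive, so that the pressure does not take a logarithm of 0.\<close>

lemma stable_preimage_nonempty:
  assumes "x \<in> X" "0 < \<epsilon>"
  shows "(T ^^ n) -` stable_set T X x \<epsilon> \<inter> X \<noteq> {}"
proof -
  obtain z where "z \<in> X" "(T ^^ n) z = x" using funpow_image assms(1) by (metis imageE)
  then show ?thesis using assms by (auto simp: stable_set_def)
qed

text \<open>By compactness, the sets of points following \<^term>\<open>x\<close> up to time \<^term>\<open>k\<close> shrink to the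
  stable set, so nothing is lost in the limit but a factor of 2 in the scale.\<close>

lemma Pn_stable_preimage_ge:
  assumes x: "x \<in> X" and n: "0 < n" and \<delta>: "0 < \<delta>" and f: "continuous_on X f"
  shows "\<exists>k0. \<forall>k\<ge>k0. \<forall>K. K \<subseteq> {y \<in> X. \<forall>i<k. dist ((T ^^ i) x) ((T ^^ i) ((T ^^ n) y)) \<le> \<epsilon>} \<longrightarrow>
    Pn T f n (2 * \<delta>) K \<le> exp 1 * Pn T f n \<delta> ((T ^^ n) -` stable_set T X x \<epsilon> \<inter> X)"
proof -
  let ?W = "(T ^^ n) -` stable_set T X x \<epsilon> \<inter> X"
  define F where "F k = {y \<in> X. \<forall>i<k. dist ((T ^^ i) x) ((T ^^ i) ((T ^^ n) y)) \<le> \<epsilon>}" for k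
  have W_eq: "?W = (\<Inter>k. F k)"
    by (auto simp: F_def stable_set_def funpow_in)
  have F_closed: "closed (F k)" for k
  proof -
    have "F k = X \<inter> (\<Inter>i<k. {y \<in> X. dist ((T ^^ i) x) ((T ^^ (i + n)) y) \<le> \<epsilon>})"
      by (auto simp: F_def funpow_add)
    moreover have "closed {y \<in> X. dist ((T ^^ i) x) ((T ^^ (i + n)) y) \<le> \<epsilon>}" for i
      by (intro continuous_on_closed_Collect_le continuous_intros funpow_cont compact_imp_closed compact_X)
    ultimately show ?thesis
      using compact_imp_closed[OF compact_X] by (simp only:) (intro closed_Int closed_INT ballI)
  qed
  have F_mono: "F l \<subseteq> F k" if "k \<le> l" for k l using that by (auto simp: F_def)
  have "0 < \<delta> / 2" using \<delta> by simp
  from funpow_uniform[OF this, of n] obtain r1 where r1: "0 < r1"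
    "\<And>y z i. y \<in> X \<Longrightarrow> z \<in> X \<Longrightarrow> dist y z < r1 \<Longrightarrow> i < n \<Longrightarrow> dist ((T ^^ i) y) ((T ^^ i) z) < \<delta> / 2"
    by blast
  have "uniformly_continuous_on X (birkhoff_sum T f n)"
    by (rule compact_uniformly_continuous[OF birkhoff_sum_cont[OF f] compact_X])
  then have "\<exists>r>0. \<forall>y\<in>X. \<forall>z\<in>X. dist z y < r \<longrightarrow> dist (birkhoff_sum T f n z) (birkhoff_sum T f n y) < 1"
    unfolding uniformly_continuous_on_def by (meson zero_less_one)
  then obtain r2 where r2: "0 < r2"
    "\<And>y z. y \<in> X \<Longrightarrow> z \<in> X \<Longrightarrow> dist z y < r2 \<Longrightarrow> \<bar>birkhoff_sum T f n z - birkhoff_sum T f n y\<bar> < 1"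
    unfolding dist_real_def by blast
  define r where "r = min r1 r2"
  have r: "0 < r" using r1 r2 by (simp add: r_def)
  let ?N = "\<Union>w\<in>?W. ball w r"
  \<comment> \<open>Otherwise the decreasing nonempty closed sets \<open>F k - ?N\<close> would have
    a common point; it would lie in \<open>?W\<close> and hence in \<open>?N\<close>. The radius
    depends on n, so \<open>k0\<close> does too, which is harmless as n is fixed here.\<close>
  have "\<exists>k0. F k0 \<subseteq> ?N"
  proof (rule ccontr)
    assume "\<not> ?thesis"
    then have ne: "F k - ?N \<noteq> {}" for k by blast
    have "X \<inter> (\<Inter>k\<in>UNIV. F k - ?N) \<noteq> {}"
    proof (rule compact_imp_fip_image[OF compact_X])
      show "closed (F k - ?N)" for k by (intro closed_Diff F_closed open_UN ballI open_ball)
    next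
      fix I :: "nat set" assume I: "finite I"
      obtain y where y: "y \<in> F (Max (insert 0 I)) - ?N" using ne by blast
      have "y \<in> F i" if "i \<in> I" for i
        using y F_mono[of i "Max (insert 0 I)"] that I by auto
      moreover have "y \<in> X" using y by (simp add: F_def)
      ultimately have "y \<in> X \<inter> (\<Inter>k\<in>I. F k - ?N)" using y by blast
      then show "X \<inter> (\<Inter>k\<in>I. F k - ?N) \<noteq> {}" by blast
    qed
    then obtain y where y: "\<And>k. y \<in> F k" "y \<notin> ?N" by blast
    then have "y \<in> ?W" unfolding W_eq by blast
    then have "y \<in> ?N" using r by force
    with y(2) show False by contradiction
  qed
  then obtain k0 where k0: "F k0 \<subseteq> ?N" by blast
  show ?thesis
  proof (intro exI[of _ k0] allI impI)
    fix k K assume k: "k0 \<le> k"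
      and K: "K \<subseteq> {y \<in> X. \<forall>i<k. dist ((T ^^ i) x) ((T ^^ i) ((T ^^ n) y)) \<le> \<epsilon>}"
    have "K \<subseteq> F k0" using K F_mono[OF k] unfolding F_def by blast
    then have KN: "\<forall>y\<in>K. \<exists>w\<in>?W. dist w y < r" using k0 by (auto simp: subset_iff)
    have KX: "K \<subseteq> X" using K by auto
    show "Pn T f n (2 * \<delta>) K \<le> exp 1 * Pn T f n \<delta> ?W"
    proof (rule Pn_least)
      fix E assume E: "finite E" "separated T n (2 * \<delta>) K E"
      have EK: "E \<subseteq> K" using E(2) unfolding separated_def by blast
      \<comment> \<open>Every point of \<open>E\<close> is moved into \<open>?W\<close>. Two
        displacements of \<delta> / 2 in Bowen distance reduce the separation from 2 \<delta> to
        \<delta>, and a change of each Birkhoff sum by less than 1 costs the factor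
        \<open>exp 1\<close>.\<close>
      obtain g where g: "\<And>y. y \<in> E \<Longrightarrow> g y \<in> ?W" "\<And>y. y \<in> E \<Longrightarrow> dist (g y) y < r"
        using KN EK by (metis subsetD)
      have gX: "g y \<in> X" and EX: "y \<in> X" if "y \<in> E" for y using g(1)[OF that] EK KX that by auto
      have far: "\<exists>i<n. \<delta> < dist ((T ^^ i) (g y)) ((T ^^ i) (g z))" if yz: "y \<in> E" "z \<in> E" "y \<noteq> z" for y z
      proof -
        obtain i where i: "i < n" "2 * \<delta> < dist ((T ^^ i) y) ((T ^^ i) z)"
          using separatedD[OF E(2) n yz] by blast
        have a: "dist ((T ^^ i) (g y)) ((T ^^ i) y) < \<delta> / 2"
          by (rule r1(2)) (use g(2)[OF yz(1)] gX EX yz i in \<open>auto simp: r_def\<close>)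
        have b: "dist ((T ^^ i) (g z)) ((T ^^ i) z) < \<delta> / 2"
          by (rule r1(2)) (use g(2)[OF yz(2)] gX EX yz i in \<open>auto simp: r_def\<close>)
        have "dist ((T ^^ i) y) ((T ^^ i) z) \<le> dist ((T ^^ i) y) ((T ^^ i) (g y))
            + dist ((T ^^ i) (g y)) ((T ^^ i) (g z)) + dist ((T ^^ i) (g z)) ((T ^^ i) z)"
          using dist_triangle[of "(T ^^ i) y" "(T ^^ i) z" "(T ^^ i) (g y)"]
            dist_triangle[of "(T ^^ i) (g y)" "(T ^^ i) z" "(T ^^ i) (g z)"] by linarith
        then have "\<delta> < dist ((T ^^ i) (g y)) ((T ^^ i) (g z))"
          using a b i by (simp add: dist_commute)
        with i show ?thesis by blast
      qed
      have inj: "inj_on g E"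
      proof (rule inj_onI, rule ccontr)
        fix y z assume "y \<in> E" "z \<in> E" "g y = g z" "y \<noteq> z"
        then show False using far[of y z] \<delta> by auto
      qed
      have sep: "separated T n \<delta> ?W (g ` E)"
        unfolding separated_def
      proof (intro conjI ballI impI)
        fix u v assume uv: "u \<in> g ` E" "v \<in> g ` E" "u \<noteq> v"
        then obtain y z where yz: "y \<in> E" "z \<in> E" "u = g y" "v = g z" by blast
        then have "\<exists>i<n. \<delta> < dist ((T ^^ i) u) ((T ^^ i) v)" using far[of y z] uv(3) by blast
        then show "\<delta> < bowen_dist T n u v" using bowen_dist_less_iff[OF n] by blast
      qed (use g(1) in blast)
      have "(\<Sum>y\<in>E. exp (birkhoff_sum T f n y)) \<le> (\<Sum>y\<in>E. exp 1 * exp (birkhoff_sum T f n (g y)))"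
      proof (rule sum_mono)
        fix y assume y: "y \<in> E"
        have "\<bar>birkhoff_sum T f n (g y) - birkhoff_sum T f n y\<bar> < 1"
          by (rule r2(2)) (use g(2)[OF y] gX EX y in \<open>auto simp: r_def\<close>)
        then show "exp (birkhoff_sum T f n y) \<le> exp 1 * exp (birkhoff_sum T f n (g y))"
          unfolding exp_add[symmetric] by simp
      qed
      also have "\<dots> = exp 1 * (\<Sum>u\<in>g ` E. exp (birkhoff_sum T f n u))"
        by (simp add: sum.reindex[OF inj] sum_distrib_left)
      also have "\<dots> \<le> exp 1 * Pn T f n \<delta> ?W"
        using n \<delta> f E(1) sep by (intro mult_left_mono Pn_upper) auto
      finally show "(\<Sum>y\<in>E. exp (birkhoff_sum T f n y)) \<le> exp 1 * Pn T f n \<delta> ?W" .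
    qed
  qed
qed

text \<open>A separated set of greatest cardinality spans, since a point far from all its members
  could be added.\<close>

lemma maximal_separated:
  assumes n: "0 < n" and \<delta>: "0 < \<delta>" and K: "K \<subseteq> X"
  shows "\<exists>E. finite E \<and> separated T n \<delta> K E \<and>
    (\<forall>y\<in>K. \<exists>x\<in>E. \<forall>i<n. dist ((T ^^ i) x) ((T ^^ i) y) \<le> \<delta>)"
proof -
  obtain N where N: "\<And>E. separated T n \<delta> X E \<Longrightarrow> finite E \<and> card E \<le> N"
    using separated_card_bound[OF n \<delta>] by blast
  let ?P = "\<lambda>m. \<exists>E. separated T n \<delta> K E \<and> card E = m"
  have "?P 0" by (intro exI[of _ "{}"]) (simp add: separated_def)
  moreover have "\<forall>m. ?P m \<longrightarrow> m \<le> N" using N separated_subset[OF _ K] by blast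
  ultimately have m: "?P (Greatest ?P)" "\<And>l. ?P l \<Longrightarrow> l \<le> Greatest ?P"
    using GreatestI_nat[of ?P 0 N] Greatest_le_nat[of ?P _ N] by blast+
  then obtain E where E: "separated T n \<delta> K E" "card E = Greatest ?P" by blast
  have fin: "finite E" using N[OF separated_subset[OF E(1) K]] by blast
  have "\<exists>x\<in>E. \<forall>i<n. dist ((T ^^ i) x) ((T ^^ i) y) \<le> \<delta>" if y: "y \<in> K" for y
  proof (rule ccontr)
    assume "\<not> ?thesis"
    then have far: "\<delta> < bowen_dist T n x y" if "x \<in> E" for x
      using that unfolding bowen_dist_less_iff[OF n] by (meson not_le)
    have "y \<notin> E"
    proof
      assume "y \<in> E"
      from far[OF this] show False using \<delta> unfolding bowen_dist_less_iff[OF n] by simp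
    qed
    have "separated T n \<delta> K (insert y E)"
      using E(1) y far far[unfolded bowen_dist_commute[of T n _ y]] unfolding separated_def by blast
    then have "card (insert y E) \<le> Greatest ?P" using m(2) by blast
    then show False using fin \<open>y \<notin> E\<close> E(2) by simp
  qed
  then show ?thesis using E fin by blast
qed

end

section \<open>Pressure of preimages of stable sets\<close>

lemma set_wrd: "z \<in> A \<Longrightarrow> (\<And>y. y \<in> A \<Longrightarrow> T y \<in> A) \<Longrightarrow> set (wrd T q n z) \<subseteq> q ` A"
  by (induction n arbitrary: z) auto

locale ergodic_compact_system = ergodic_prob M T
  for M :: "'a::metric_space measure" and T :: "'a \<Rightarrow> 'a" +
  assumes compact_space: "compact (space M)" and T_cont: "continuous_on (space M) T"
    and T_image: "T ` space M = space M"
    and sets_M: "sets M = sets (restrict_space borel (space M))"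

sublocale ergodic_compact_system \<subseteq> compact_system "space M" T
  by standard (fact compact_space T_cont T_image)+

context ergodic_compact_system
begin

lemma continuous_borel_measurable:
  fixes f :: "'a \<Rightarrow> real"
  assumes "continuous_on (space M) f"
  shows "f \<in> borel_measurable M"
  using borel_measurable_continuous_on_restrict[OF assms] measurable_cong_sets[OF sets_M refl] by blast

lemma continuous_integrable:
  fixes f :: "'a \<Rightarrow> real"
  assumes f: "continuous_on (space M) f"
  shows "integrable M f"
proof -
  have "bounded (f ` space M)"
    by (intro compact_imp_bounded compact_continuous_image f compact_space)
  then obtain B where "\<And>x. x \<in> space M \<Longrightarrow> norm (f x) \<le> B" unfolding bounded_iff by auto
  then show ?thesis
    by (intro integrable_const_bound[of _ B] AE_I2 continuous_borel_measurable f)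
qed

lemma prob_cell:
  assumes q: "simple_function M q"
  shows "prob {y \<in> space M. wrd T q k ((T ^^ n) y) = w} = prob {y \<in> space M. wrd T q k y = w}"
proof -
  have "{y \<in> space M. wrd T q k ((T ^^ n) y) = w}
      = (T ^^ n) -` {y \<in> space M. wrd T q k y = w} \<inter> space M"
    using funpow_in by auto
  then show ?thesis
    using prob_vimage_funpow[OF simple_function_fiber_sets[OF simple_function_wrd[OF q]]] by simp
qed

text \<open>The counting argument, with \<open>Z\<close> as the set of typical points. A spanning
  separated set in \<open>C \<inter> Z\<close> has at most \<open>Pn\<close> times exp (- c) points,
  the Hamming ball of each accounts for at most b words, and each word has mass at most a times that
  of \<open>C\<close>.\<close>

lemma prob_cell_Int_le:
  fixes a b c s :: real
  assumes q: "simple_function M q" and n: "0 < n" and \<delta>: "0 < \<delta>" and f: "continuous_on (space M) f"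
    and C: "C = {y \<in> space M. wrd T q k ((T ^^ n) y) = w}" and Z: "Z \<subseteq> space M"
    and a: "0 \<le> a"
    and info: "\<And>z. z \<in> Z \<Longrightarrow>
      fiber_prob (wrd T q (n + k)) z \<le> a * fiber_prob (wrd T q k) ((T ^^ n) z)"
    and ham: "\<And>y z. y \<in> Z \<Longrightarrow> z \<in> Z \<Longrightarrow> (\<forall>i<n. dist ((T ^^ i) y) ((T ^^ i) z) \<le> \<delta>) \<Longrightarrow>
      real (hamming (wrd T q n y) (wrd T q n z)) \<le> s"
    and count: "\<And>u. length u = n \<Longrightarrow> real (card {v. set v \<subseteq> q ` space M \<and> length v = length u \<and>
      real (hamming u v) \<le> s}) \<le> b"
    and fsum: "\<And>z. z \<in> Z \<Longrightarrow> c \<le> birkhoff_sum T f n z"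
  shows "prob (C \<inter> Z) \<le> Pn T f n \<delta> C * exp (- c) * b * a * prob C"
proof -
  have CX: "C \<subseteq> space M" unfolding C by auto
  have fin: "finite (q ` space M)" by (rule simple_functionD(1)[OF q])
  have "C \<inter> Z \<subseteq> space M" using CX by blast
  from maximal_separated[OF n \<delta> this] obtain E where E: "finite E" "separated T n \<delta> (C \<inter> Z) E"
    "\<forall>y\<in>C \<inter> Z. \<exists>x\<in>E. \<forall>i<n. dist ((T ^^ i) x) ((T ^^ i) y) \<le> \<delta>" by blast
  have EZ: "E \<subseteq> C \<inter> Z" using E(2) by (simp add: separated_def)
  have "real (card E) * exp c = (\<Sum>x\<in>E. exp c)" by simp
  also have "\<dots> \<le> (\<Sum>x\<in>E. exp (birkhoff_sum T f n x))"
    using EZ fsum by (intro sum_mono) auto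
  also have "\<dots> \<le> Pn T f n \<delta> C"
    using n \<delta> f CX E(1) separated_subset[OF E(2), of C] by (intro Pn_upper) auto
  finally have cardE: "real (card E) \<le> Pn T f n \<delta> C * exp (- c)"
    by (simp add: exp_minus field_simps)
  let ?B = "\<lambda>u. {v. set v \<subseteq> q ` space M \<and> length v = length u \<and> real (hamming u v) \<le> s}"
  have finB: "finite (?B u)" for u
    by (rule finite_subset[OF _ finite_lists_length_eq[OF fin, of "length u"]]) auto
  \<comment> \<open>Any word of length n would do: the bound \<open>count\<close> dominates a
    cardinality.\<close>
  have b: "0 \<le> b" using count[of "replicate n undefined"] by (meson length_replicate of_nat_0_le_iff order_trans)
  define U where "U = wrd T q n ` (C \<inter> Z)"
  have "U \<subseteq> (\<Union>x\<in>E. ?B (wrd T q n x))"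
  proof
    fix u assume "u \<in> U"
    then obtain y where y: "y \<in> C \<inter> Z" "u = wrd T q n y" unfolding U_def by blast
    then obtain x where x: "x \<in> E" "\<forall>i<n. dist ((T ^^ i) x) ((T ^^ i) y) \<le> \<delta>" using E(3) by blast
    have "real (hamming (wrd T q n x) u) \<le> s"
      unfolding y(2) by (rule ham) (use x y EZ in auto)
    moreover have "set u \<subseteq> q ` space M"
      unfolding y(2) by (rule set_wrd) (use y CX T_space in auto)
    ultimately show "u \<in> (\<Union>x\<in>E. ?B (wrd T q n x))" using x(1) y(2) by auto
  qed
  moreover have "finite (\<Union>x\<in>E. ?B (wrd T q n x))" by (intro finite_UN_I E(1) finB)
  ultimately have finU: "finite U" and "card U \<le> card (\<Union>x\<in>E. ?B (wrd T q n x))"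
    by (auto intro: finite_subset card_mono)
  note this(2)
  also have "\<dots> \<le> (\<Sum>x\<in>E. card (?B (wrd T q n x)))" by (rule card_UN_le[OF E(1)])
  finally have "real (card U) \<le> (\<Sum>x\<in>E. real (card (?B (wrd T q n x))))" by (simp flip: of_nat_sum)
  also have "\<dots> \<le> (\<Sum>x\<in>E. b)" by (intro sum_mono count) simp
  also have "\<dots> = real (card E) * b" by simp
  also have "\<dots> \<le> Pn T f n \<delta> C * exp (- c) * b" by (rule mult_right_mono[OF cardE b])
  finally have cardU: "real (card U) \<le> Pn T f n \<delta> C * exp (- c) * b" .
  define D where "D u = {y \<in> space M. wrd T q (n + k) y = u @ w}" for u
  have Dm: "D u \<in> sets M" for u
    unfolding D_def by (rule simple_function_fiber_sets[OF simple_function_wrd[OF q]])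
  have "C \<inter> Z \<subseteq> (\<Union>u\<in>U. D u)"
    using Z unfolding U_def D_def C by (auto simp: wrd_add)
  then have "prob (C \<inter> Z) \<le> prob (\<Union>u\<in>U. D u)"
    using Dm finU by (intro finite_measure_mono) auto
  also have "\<dots> \<le> (\<Sum>u\<in>U. prob (D u))"
    using Dm finU by (intro finite_measure_subadditive_finite) auto
  also have "\<dots> \<le> (\<Sum>u\<in>U. a * prob C)"
  proof (rule sum_mono)
    fix u assume "u \<in> U"
    then obtain z where z: "z \<in> C" "z \<in> Z" "u = wrd T q n z" unfolding U_def by blast
    have w: "wrd T q k ((T ^^ n) z) = w" using z(1) unfolding C by simp
    then have "prob (D u) = fiber_prob (wrd T q (n + k)) z"
      unfolding D_def fiber_prob_def z(3) by (simp add: wrd_add)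
    also have "\<dots> \<le> a * fiber_prob (wrd T q k) ((T ^^ n) z)" by (rule info[OF z(2)])
    also have "\<dots> = a * prob C" unfolding C prob_cell[OF q] by (simp add: fiber_prob_def w)
    finally show "prob (D u) \<le> a * prob C" .
  qed
  also have "\<dots> = real (card U) * (a * prob C)" by simp
  also have "\<dots> \<le> Pn T f n \<delta> C * exp (- c) * b * (a * prob C)"
    using a by (intro mult_right_mono[OF cardU]) auto
  finally show ?thesis by (simp add: mult.assoc)
qed

text \<open>The cells with a small pressure sum are disjoint, so the bounds on their typical parts
  add up to an exponentially small mass. The scale comes from \<theta> and the set \<open>V\<close>,
  chosen before \<open>e\<close>, n and k.\<close>

lemma prob_small_pressure_cells:
  assumes q: "simple_function M q" and f: "continuous_on (space M) f" and \<kappa>: "0 < \<kappa>"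
  shows "\<exists>\<delta>>0. \<forall>e>0. \<exists>N K. \<forall>n\<ge>N. \<forall>k\<ge>K. prob {x \<in> space M.
    Pn T f n \<delta> {y \<in> space M. wrd T q k ((T ^^ n) y) = wrd T q k x}
      < exp (real n * (entropy_rate q + (\<integral>x. f x \<partial>M) - \<kappa>))} \<le> e"
proof -
  let ?h = "entropy_rate q" and ?I = "\<integral>x. f x \<partial>M"
  \<comment> \<open>Information, Birkhoff sums and Hamming balls lose one quarter each; the last
    quarter is the rate of decay exp (- \<eta> n).\<close>
  define \<eta> where "\<eta> = \<kappa> / 4"
  have \<eta>: "0 < \<eta>" using \<kappa> by (simp add: \<eta>_def)
  have fin: "finite (q ` space M)" by (rule simple_functionD(1)[OF q])
  obtain \<theta> where \<theta>: "0 < \<theta>"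
    "\<And>u. real (card {v. set v \<subseteq> q ` space M \<and> length v = length u \<and>
      real (hamming u v) \<le> \<theta> * real (length u)}) \<le> exp (\<eta> * real (length u))"
    using hamming_ball_subexponential[OF fin \<eta>] by blast
  have "0 < \<theta> / 2" using \<theta> by simp
  from simple_function_locally_constant[OF prob_space_axioms compact_space sets_M q this]
  obtain V \<delta> where V: "V \<in> sets M" "prob V < \<theta> / 2" and \<delta>: "0 < \<delta>"
    and loc: "\<And>y z. y \<in> space M - V \<Longrightarrow> z \<in> space M - V \<Longrightarrow> dist y z \<le> \<delta> \<Longrightarrow> q y = q z" by blast
  have int_f: "integrable M f" by (rule continuous_integrable[OF f])
  have f_meas[measurable]: "f \<in> borel_measurable M" by (rule continuous_borel_measurable[OF f])
  \<comment> \<open>The lower ergodic bound for the negated indicator limits the visits to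
    \<open>V\<close> to \<theta> n / 2, so that two orbits together allow a Hamming distance of
    \<theta> n.\<close>
  let ?g = "\<lambda>x. - indicator V x :: real"
  have int_g: "integrable M ?g" using V(1) by (simp add: less_top[symmetric])
  have Ig: "- \<theta> / 2 < (\<integral>x. ?g x \<partial>M)"
  proof -
    have "V \<inter> space M = V" using sets.sets_into_space[OF V(1)] by blast
    then have "(\<integral>x. ?g x \<partial>M) = - prob V" by simp
    then show ?thesis using V(2) by simp
  qed
  have If: "?I - \<eta> < ?I" using \<eta> by simp
  define B1 where "B1 n k = {z \<in> space M. fiber_prob (wrd T q (n + k)) z
    > exp (- (real n * (?h - \<eta>))) * fiber_prob (wrd T q k) ((T ^^ n) z)}" for n k
  define B2 where "B2 n = {x \<in> space M. \<not> (?I - \<eta>) * real n < birkhoff_sum T f n x}" for n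
  define B3 where "B3 n = {x \<in> space M. \<not> (- \<theta> / 2) * real n < birkhoff_sum T ?g n x}" for n
  have [measurable]: "fiber_prob (wrd T q m) \<in> borel_measurable M" for m
    by (rule borel_measurable_simple_function[OF simple_function_fiber_prob[OF simple_function_wrd[OF q]]])
  have B1m: "B1 n k \<in> sets M" for n k unfolding B1_def by measurable
  have B2m: "B2 n \<in> sets M" for n unfolding B2_def by measurable
  have [measurable]: "birkhoff_sum T ?g n \<in> borel_measurable M" for n
    using int_g by (intro birkhoff_sum_measurable) auto
  have B3m: "B3 n \<in> sets M" for n unfolding B3_def by measurable
  define R where "R n k = {x \<in> space M.
    Pn T f n \<delta> {y \<in> space M. wrd T q k ((T ^^ n) y) = wrd T q k x} < exp (real n * (?h + ?I - \<kappa>))}" for n k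
  have R_le: "prob (R n k) \<le> prob (B1 n k) + prob (B2 n) + prob (B3 n) + exp (- \<eta> * real n)"
    if n: "0 < n" for n k
  proof -
    define C where "C w = {y \<in> space M. wrd T q k ((T ^^ n) y) = w}" for w
    define W where "W = {w \<in> wrd T q k ` space M. Pn T f n \<delta> (C w) < exp (real n * (?h + ?I - \<kappa>))}"
    have finW: "finite (wrd T q k ` space M)" by (rule simple_functionD(1)[OF simple_function_wrd[OF q]])
    define Z where "Z = space M - (B1 n k \<union> B2 n \<union> B3 n)"
    have Zm: "Z \<in> sets M" unfolding Z_def using B1m B2m B3m by auto
    have Cm: "C w \<in> sets M" for w
      unfolding C_def
      by (intro simple_function_fiber_sets simple_function_comp[OF funpow_measurable simple_function_wrd[OF q]])
    have Rm: "R n k \<in> sets M"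
    proof -
      \<comment> \<open>The pressure sum depends on x only through its k-word, a simple function; no
        regularity of \<open>Pn\<close> in x is involved.\<close>
      have "R n k = wrd T q k -` {w. Pn T f n \<delta> (C w) < exp (real n * (?h + ?I - \<kappa>))} \<inter> space M"
        unfolding R_def C_def by auto
      then show ?thesis by (simp only: simple_functionD(2)[OF simple_function_wrd[OF q]])
    qed
    have cell: "prob (C w \<inter> Z) \<le> exp (- \<eta> * real n) * prob (C w)" if w: "w \<in> W" for w
    proof -
      have "prob (C w \<inter> Z) \<le> Pn T f n \<delta> (C w) * exp (- ((?I - \<eta>) * real n)) * exp (\<eta> * real n)
        * exp (- (real n * (?h - \<eta>))) * prob (C w)"
      proof (rule prob_cell_Int_le[OF q n \<delta> f C_def, where s = "\<theta> * real n"])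
        show "Z \<subseteq> space M" unfolding Z_def by auto
        show "fiber_prob (wrd T q (n + k)) z
            \<le> exp (- (real n * (?h - \<eta>))) * fiber_prob (wrd T q k) ((T ^^ n) z)" if "z \<in> Z" for z
          using that unfolding Z_def B1_def by auto
        show "(?I - \<eta>) * real n \<le> birkhoff_sum T f n z" if "z \<in> Z" for z
          using that unfolding Z_def B2_def by auto
        show "real (card {v. set v \<subseteq> q ` space M \<and> length v = length u \<and>
            real (hamming u v) \<le> \<theta> * real n}) \<le> exp (\<eta> * real n)" if "length u = n" for u
          using \<theta>(2)[of u] that by simp
        show "real (hamming (wrd T q n y) (wrd T q n z)) \<le> \<theta> * real n"
          if yz: "y \<in> Z" "z \<in> Z" and d: "\<forall>i<n. dist ((T ^^ i) y) ((T ^^ i) z) \<le> \<delta>" for y z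
        proof -
          have neg: "birkhoff_sum T ?g n x = - birkhoff_sum T (indicator V) n x" for x
            by (simp add: birkhoff_sum_def sum_negf)
          have "real (hamming (wrd T q n y) (wrd T q n z))
              \<le> birkhoff_sum T (indicator V) n y + birkhoff_sum T (indicator V) n z"
            by (rule hamming_wrd_le_birkhoff_sum[where X = "space M" and d = \<delta>])
              (use loc T_space yz d in \<open>auto simp: Z_def\<close>)
          moreover have low: "(- \<theta> / 2) * real n < - birkhoff_sum T (indicator V) n x" if "x \<in> Z" for x
            using that neg[of x] unfolding Z_def B3_def by auto
          ultimately show ?thesis using low[OF yz(1)] low[OF yz(2)] by linarith
        qed
      qed simp
      also have "\<dots> \<le> exp (real n * (?h + ?I - \<kappa>)) * exp (- ((?I - \<eta>) * real n)) * exp (\<eta> * real n)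
        * exp (- (real n * (?h - \<eta>))) * prob (C w)"
        using w unfolding W_def by (intro mult_right_mono) auto
      also have "\<dots> = exp (- \<eta> * real n) * prob (C w)"
      proof -
        have "real n * (?h + ?I - \<kappa>) + - ((?I - \<eta>) * real n) + \<eta> * real n + - (real n * (?h - \<eta>))
          = - \<eta> * real n"
          by (simp add: \<eta>_def algebra_simps)
        then show ?thesis by (simp only: exp_add[symmetric])
      qed
      finally show ?thesis .
    qed
    have "(\<Sum>w\<in>wrd T q k ` space M. prob (C w)) = 1"
      using simple_function_integral(2)[OF simple_function_wrd[OF q], of "\<lambda>_. 1" k]
      unfolding C_def prob_cell[OF q] by (simp add: prob_space)
    then have sum1: "(\<Sum>w\<in>W. prob (C w)) \<le> 1"
      using sum_mono2[OF finW, of W "\<lambda>w. prob (C w)"] unfolding W_def by auto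
    \<comment> \<open>The set \<open>R n k\<close> contains points at time n, the cells and
      \<open>Z\<close> contain points at time 0; pulling back by T^n brings them together and
      preserves the probability.\<close>
    have sub: "(T ^^ n) -` R n k \<inter> space M \<subseteq> (B1 n k \<union> B2 n \<union> B3 n) \<union> (\<Union>w\<in>W. C w \<inter> Z)"
    proof
      fix z assume z: "z \<in> (T ^^ n) -` R n k \<inter> space M"
      let ?w = "wrd T q k ((T ^^ n) z)"
      have "?w \<in> W" using z unfolding W_def R_def C_def by auto
      moreover have "z \<in> C ?w" using z unfolding C_def by auto
      ultimately show "z \<in> (B1 n k \<union> B2 n \<union> B3 n) \<union> (\<Union>w\<in>W. C w \<inter> Z)"
        using z unfolding Z_def by blast
    qed
    have finW': "finite W" using finW unfolding W_def by simp
    have Um: "(\<Union>w\<in>W. C w \<inter> Z) \<in> sets M" by (intro sets.finite_UN finW' sets.Int Cm Zm)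
    have Bm: "B1 n k \<union> B2 n \<union> B3 n \<in> sets M" by (intro sets.Un B1m B2m B3m)
    have "prob (R n k) = prob ((T ^^ n) -` R n k \<inter> space M)"
      by (rule prob_vimage_funpow[OF Rm, symmetric])
    also have "\<dots> \<le> prob ((B1 n k \<union> B2 n \<union> B3 n) \<union> (\<Union>w\<in>W. C w \<inter> Z))"
      by (rule finite_measure_mono[OF sub sets.Un[OF Bm Um]])
    also have "\<dots> \<le> prob (B1 n k \<union> B2 n \<union> B3 n) + prob (\<Union>w\<in>W. C w \<inter> Z)"
      by (rule measure_Un_le[OF Bm Um])
    also have "prob (B1 n k \<union> B2 n \<union> B3 n) \<le> prob (B1 n k \<union> B2 n) + prob (B3 n)"
      using B1m B2m B3m by (intro measure_Un_le) auto
    also have "prob (B1 n k \<union> B2 n) \<le> prob (B1 n k) + prob (B2 n)"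
      using B1m B2m by (intro measure_Un_le) auto
    also have "prob (\<Union>w\<in>W. C w \<inter> Z) \<le> (\<Sum>w\<in>W. prob (C w \<inter> Z))"
      using Cm Zm finW' by (intro finite_measure_subadditive_finite) auto
    also have "\<dots> \<le> (\<Sum>w\<in>W. exp (- \<eta> * real n) * prob (C w))" by (rule sum_mono[OF cell])
    also have "\<dots> = exp (- \<eta> * real n) * (\<Sum>w\<in>W. prob (C w))" by (simp add: sum_distrib_left)
    also have "\<dots> \<le> exp (- \<eta> * real n) * 1" by (intro mult_left_mono sum1) simp
    finally show ?thesis by simp
  qed
  show ?thesis
  proof (rule exI[of _ \<delta>], intro conjI allI impI)
    fix e :: real assume e: "0 < e"
    then have e4: "0 < e / 4" by simp
    obtain K N1 where N1: "\<And>n k. N1 \<le> n \<Longrightarrow> K \<le> k \<Longrightarrow> prob (B1 n k) \<le> e / 4"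
      using conditional_information_lower[OF q \<eta> e4] unfolding B1_def by blast
    from order_tendstoD(2)[OF birkhoff_lower_prob[OF int_f If] e4]
    obtain N2 where N2: "\<And>n. N2 \<le> n \<Longrightarrow> prob (B2 n) < e / 4"
      unfolding B2_def eventually_sequentially by auto
    from order_tendstoD(2)[OF birkhoff_lower_prob[OF int_g Ig] e4]
    obtain N3 where N3: "\<And>n. N3 \<le> n \<Longrightarrow> prob (B3 n) < e / 4"
      unfolding B3_def eventually_sequentially by auto
    have "(\<lambda>n. exp (- \<eta>) ^ n) \<longlonglongrightarrow> 0" using \<eta> by (intro LIMSEQ_power_zero) simp
    from order_tendstoD(2)[OF this e4]
    obtain N4 where N4: "\<And>n. N4 \<le> n \<Longrightarrow> exp (- \<eta>) ^ n < e / 4"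
      unfolding eventually_sequentially by auto
    have "prob (R n k) \<le> e" if n: "n \<ge> Suc (N1 + N2 + N3 + N4)" and k: "k \<ge> K" for n k
    proof -
      have "exp (- \<eta> * real n) = exp (- \<eta>) ^ n"
        using exp_of_nat_mult[of n "- \<eta>"] by (simp add: mult.commute)
      then show ?thesis
        using R_le[of n k] N1[of n k] N2[of n] N3[of n] N4[of n] n k by simp
    qed
    then show "\<exists>N K. \<forall>n\<ge>N. \<forall>k\<ge>K. prob {x \<in> space M.
      Pn T f n \<delta> {y \<in> space M. wrd T q k ((T ^^ n) y) = wrd T q k x}
        < exp (real n * (?h + ?I - \<kappa>))} \<le> e"
      unfolding R_def by blast
  qed (rule \<delta>)
qed

text \<open>A point outside \<open>S n\<close> is good for arbitrarily large k, hence for some k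
  beyond the threshold of \<open>Pn_stable_preimage_ge\<close>. As the probabilities of
  \<open>S n\<close> tend to 0, almost no point lies in all late \<open>S n\<close>; no summability
  is required.\<close>

lemma AE_frequently_Pn_stable:
  assumes q: "simple_function M q" and f: "continuous_on (space M) f" and \<kappa>: "0 < \<kappa>"
    and diam: "\<And>y z. y \<in> space M \<Longrightarrow> z \<in> space M \<Longrightarrow> q y = q z \<Longrightarrow> dist y z \<le> \<epsilon>"
  shows "\<exists>\<delta>>0. AE x in M. \<forall>m. \<exists>n>m. exp (real n * (entropy_rate q + (\<integral>x. f x \<partial>M) - \<kappa>))
    \<le> exp 1 * Pn T f n \<delta> ((T ^^ n) -` stable_set T (space M) x \<epsilon> \<inter> space M)"
proof -
  let ?c = "\<lambda>n. exp (real n * (entropy_rate q + (\<integral>x. f x \<partial>M) - \<kappa>))"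
  let ?C = "\<lambda>n k x. {y \<in> space M. wrd T q k ((T ^^ n) y) = wrd T q k x}"
  obtain \<delta> where \<delta>: "0 < \<delta>" and small: "\<And>e. 0 < e \<Longrightarrow> \<exists>N K. \<forall>n\<ge>N. \<forall>k\<ge>K.
      prob {x \<in> space M. Pn T f n \<delta> (?C n k x) < ?c n} \<le> e"
    using prob_small_pressure_cells[OF q f \<kappa>] by blast
  define R where "R n k = {x \<in> space M. Pn T f n \<delta> (?C n k x) < ?c n}" for n k
  have Rm: "R n k \<in> sets M" for n k
  proof -
    have "R n k = wrd T q k -` {w. Pn T f n \<delta> {y \<in> space M. wrd T q k ((T ^^ n) y) = w} < ?c n} \<inter> space M"
      unfolding R_def by auto
    then show ?thesis by (simp only: simple_functionD(2)[OF simple_function_wrd[OF q]])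
  qed
  define S where "S n = (\<Union>k0. \<Inter>k\<in>{k0..}. R n k)" for n
  have Im: "(\<Inter>k\<in>{k0..}. R n k) \<in> sets M" for n k0
    using Rm by (intro sets.countable_INT') auto
  have Sm: "S n \<in> sets M" for n unfolding S_def using Im by auto
  have S_small: "\<exists>N. \<forall>n\<ge>N. prob (S n) \<le> e" if e: "0 < e" for e
  proof -
    obtain N K where NK: "\<And>n k. N \<le> n \<Longrightarrow> K \<le> k \<Longrightarrow> prob (R n k) \<le> e"
      using small[OF e] unfolding R_def by blast
    have "prob (S n) \<le> e" if n: "N \<le> n" for n
    proof (rule LIMSEQ_le_const2)
      \<comment> \<open>Continuity from below: each intersection lies in a single
        \<open>R n k\<close> with k \<ge> \<open>K\<close>, so a bound valid for all large k passes
        to the increasing union.\<close>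
      show "(\<lambda>k0. prob (\<Inter>k\<in>{k0..}. R n k)) \<longlonglongrightarrow> prob (S n)"
        unfolding S_def using Im
        by (intro finite_Lim_measure_incseq incseq_SucI INT_anti_mono) auto
      have "prob (\<Inter>k\<in>{k0..}. R n k) \<le> e" for k0
      proof -
        have "prob (\<Inter>k\<in>{k0..}. R n k) \<le> prob (R n (max k0 K))"
          by (intro finite_measure_mono Rm INT_lower) auto
        also have "\<dots> \<le> e" by (rule NK[OF n]) simp
        finally show ?thesis .
      qed
      then show "\<exists>N. \<forall>k0\<ge>N. prob (\<Inter>k\<in>{k0..}. R n k) \<le> e" by blast
    qed
    then show ?thesis by blast
  qed
  have "AE x in M. x \<notin> (\<Inter>n\<in>{m<..}. S n)" for m
  proof (rule AE_not_in)
    have Gm: "(\<Inter>n\<in>{m<..}. S n) \<in> sets M" using Sm by (intro sets.countable_INT') auto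
    have "prob (\<Inter>n\<in>{m<..}. S n) \<le> 0"
    proof (rule field_le_epsilon)
      fix e :: real assume "0 < e"
      then obtain N where N: "\<And>n. N \<le> n \<Longrightarrow> prob (S n) \<le> e" using S_small by blast
      have "prob (\<Inter>n\<in>{m<..}. S n) \<le> prob (S (max (Suc m) N))"
        by (intro finite_measure_mono Sm INT_lower) auto
      also have "\<dots> \<le> e" by (rule N) simp
      finally show "prob (\<Inter>n\<in>{m<..}. S n) \<le> 0 + e" by simp
    qed
    then have "prob (\<Inter>n\<in>{m<..}. S n) = 0" by (simp add: measure_le_0_iff)
    then show "(\<Inter>n\<in>{m<..}. S n) \<in> null_sets M"
      using Gm by (simp add: null_sets_def emeasure_eq_measure)
  qed
  then have "AE x in M. \<forall>m. x \<notin> (\<Inter>n\<in>{m<..}. S n)" by (simp add: AE_all_countable)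
  moreover have "AE x in M. x \<in> space M" by simp
  ultimately have "AE x in M. \<forall>m. \<exists>n>m. ?c n
    \<le> exp 1 * Pn T f n (\<delta> / 2) ((T ^^ n) -` stable_set T (space M) x \<epsilon> \<inter> space M)"
  proof eventually_elim
    case (elim x)
    show ?case
    proof
      fix m
      obtain n where n: "m < n" "x \<notin> S n" using elim(1) by blast
      have "\<exists>k0. \<forall>k\<ge>k0. \<forall>K. K \<subseteq> {y \<in> space M. \<forall>i<k. dist ((T ^^ i) x) ((T ^^ i) ((T ^^ n) y)) \<le> \<epsilon>} \<longrightarrow>
        Pn T f n (2 * (\<delta> / 2)) K \<le> exp 1 * Pn T f n (\<delta> / 2) ((T ^^ n) -` stable_set T (space M) x \<epsilon> \<inter> space M)"
        by (rule Pn_stable_preimage_ge) (use elim(2) n \<delta> f in auto)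
      then obtain k0 where k0: "\<forall>k\<ge>k0. \<forall>K.
        K \<subseteq> {y \<in> space M. \<forall>i<k. dist ((T ^^ i) x) ((T ^^ i) ((T ^^ n) y)) \<le> \<epsilon>} \<longrightarrow>
        Pn T f n (2 * (\<delta> / 2)) K \<le> exp 1 * Pn T f n (\<delta> / 2) ((T ^^ n) -` stable_set T (space M) x \<epsilon> \<inter> space M)"
        by blast
      obtain k where k: "k0 \<le> k" "x \<notin> R n k" using n(2) unfolding S_def by auto
      have "?c n \<le> Pn T f n (2 * (\<delta> / 2)) (?C n k x)" using k(2) elim(2) unfolding R_def by auto
      also have "\<dots> \<le> exp 1 * Pn T f n (\<delta> / 2) ((T ^^ n) -` stable_set T (space M) x \<epsilon> \<inter> space M)"
      proof (rule k0[rule_format, OF k(1)], intro subsetI CollectI conjI allI impI)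
        fix y i assume y: "y \<in> ?C n k x" and i: "i < k"
        then have "q ((T ^^ i) ((T ^^ n) y)) = q ((T ^^ i) x)" by (auto simp: wrd_eq_iff)
        then show "dist ((T ^^ i) x) ((T ^^ i) ((T ^^ n) y)) \<le> \<epsilon>"
          using y elim(2) by (intro diam funpow_in) auto
      qed auto
      finally show "\<exists>n>m. ?c n
        \<le> exp 1 * Pn T f n (\<delta> / 2) ((T ^^ n) -` stable_set T (space M) x \<epsilon> \<inter> space M)"
        using n(1) by blast
    qed
  qed
  moreover have "0 < \<delta> / 2" using \<delta> by simp
  ultimately show ?thesis by blast
qed

end

section \<open>Monotone limits in the two scales\<close>

lemma Lim_at_right_antimono:
  fixes F :: "real \<Rightarrow> ereal"
  assumes "\<And>a b. 0 < a \<Longrightarrow> a \<le> b \<Longrightarrow> F b \<le> F a"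
  shows "Lim (at_right 0) F = (SUP a\<in>{0<..}. F a)"
proof (rule tendsto_Lim)
  show "(F \<longlongrightarrow> (SUP a\<in>{0<..}. F a)) (at_right 0)"
  proof (rule order_tendstoI)
    fix c assume "c < (SUP a\<in>{0<..}. F a)"
    then obtain a where a: "0 < a" "c < F a" by (auto simp: less_SUP_iff)
    show "\<forall>\<^sub>F x in at_right 0. c < F x"
      unfolding eventually_at_right_field
      using a assms by (intro exI[of _ a]) (auto intro: less_le_trans)
  next
    fix c assume c: "(SUP a\<in>{0<..}. F a) < c"
    show "\<forall>\<^sub>F x in at_right 0. F x < c"
      unfolding eventually_at_right_field
      using c by (intro exI[of _ 1]) (auto intro: le_less_trans[OF SUP_upper])
  qed
qed simp

lemma Lim_at_right_mono:
  fixes F :: "real \<Rightarrow> ereal"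
  assumes "\<And>a b. 0 < a \<Longrightarrow> a \<le> b \<Longrightarrow> F a \<le> F b"
  shows "Lim (at_right 0) F = (INF a\<in>{0<..}. F a)"
proof (rule tendsto_Lim)
  show "(F \<longlongrightarrow> (INF a\<in>{0<..}. F a)) (at_right 0)"
  proof (rule order_tendstoI)
    fix c assume c: "c < (INF a\<in>{0<..}. F a)"
    show "\<forall>\<^sub>F x in at_right 0. c < F x"
      unfolding eventually_at_right_field
      using c by (intro exI[of _ 1]) (auto intro: less_le_trans[OF _ INF_lower])
  next
    fix c assume "(INF a\<in>{0<..}. F a) < c"
    then obtain a where a: "0 < a" "F a < c" by (auto simp: INF_less_iff)
    have "F y < c" if "0 < y" "y < a" for y
      using assms[of y a] that a(2) by (auto intro: le_less_trans)
    then show "\<forall>\<^sub>F x in at_right 0. F x < c"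
      unfolding eventually_at_right_field using a(1) by blast
  qed
qed simp

lemma limsup_ge_frequently:
  fixes u :: "nat \<Rightarrow> ereal"
  assumes "\<And>m. \<exists>n\<ge>m. c \<le> u n"
  shows "c \<le> limsup u"
  unfolding limsup_INF_SUP
proof (rule INF_greatest)
  fix m
  obtain n where "m \<le> n" "c \<le> u n" using assms by blast
  then show "c \<le> (SUP n\<in>{m..}. u n)" by (intro SUP_upper2[of n]) auto
qed

context compact_system
begin

lemma ln_Pn_stable_mono:
  assumes "x \<in> X" "continuous_on X f" "0 < \<delta>" "\<delta> \<le> \<delta>'" "0 < \<epsilon>" "\<epsilon> \<le> \<epsilon>'" "0 < n"
  shows "ln (Pn T f n \<delta>' ((T ^^ n) -` stable_set T X x \<epsilon> \<inter> X)) / real n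
    \<le> ln (Pn T f n \<delta> ((T ^^ n) -` stable_set T X x \<epsilon>' \<inter> X)) / real n"
proof (rule divide_right_mono)
  have sub: "(T ^^ n) -` stable_set T X x \<epsilon> \<inter> X \<subseteq> (T ^^ n) -` stable_set T X x \<epsilon>' \<inter> X"
    by (auto simp: stable_set_def intro: order_trans[OF _ assms(6)])
  have "0 < Pn T f n \<delta>' ((T ^^ n) -` stable_set T X x \<epsilon> \<inter> X)"
    using assms stable_preimage_nonempty[of x \<epsilon> n] by (intro Pn_pos) auto
  moreover have "Pn T f n \<delta>' ((T ^^ n) -` stable_set T X x \<epsilon> \<inter> X)
      \<le> Pn T f n \<delta> ((T ^^ n) -` stable_set T X x \<epsilon>' \<inter> X)"
    using assms sub by (intro Pn_mono) auto
  ultimately show "ln (Pn T f n \<delta>' ((T ^^ n) -` stable_set T X x \<epsilon> \<inter> X))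
      \<le> ln (Pn T f n \<delta> ((T ^^ n) -` stable_set T X x \<epsilon>' \<inter> X))" by simp
qed simp

definition stable_growth :: "('a \<Rightarrow> real) \<Rightarrow> 'a \<Rightarrow> real \<Rightarrow> real \<Rightarrow> ereal" where
  "stable_growth f x \<epsilon> \<delta> =
    limsup (\<lambda>n. ereal (ln (Pn T f n \<delta> ((T ^^ n) -` stable_set T X x \<epsilon> \<inter> X)) / real n))"

lemma stable_growth_mono:
  assumes "x \<in> X" "continuous_on X f" "0 < \<delta>" "\<delta> \<le> \<delta>'" "0 < \<epsilon>" "\<epsilon> \<le> \<epsilon>'"
  shows "stable_growth f x \<epsilon> \<delta>' \<le> stable_growth f x \<epsilon>' \<delta>"
  unfolding stable_growth_def
proof (rule Limsup_mono, rule eventually_sequentiallyI[of 1])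
  fix n :: nat assume "1 \<le> n"
  then show "ereal (ln (Pn T f n \<delta>' ((T ^^ n) -` stable_set T X x \<epsilon> \<inter> X)) / real n)
    \<le> ereal (ln (Pn T f n \<delta> ((T ^^ n) -` stable_set T X x \<epsilon>' \<inter> X)) / real n)"
    unfolding ereal_less_eq using assms by (intro ln_Pn_stable_mono) auto
qed

text \<open>\<open>Lim\<close> is meaningful only if a limit exists, which monotonicity in \<delta>
  guarantees. Being a supremum, the pressure is bounded below by its value at any single
  scale.\<close>

lemma Ps_eq_SUP:
  assumes "x \<in> X" "continuous_on X f" "0 < \<epsilon>"
  shows "Ps T X f x \<epsilon> = (SUP \<delta>\<in>{0<..}. stable_growth f x \<epsilon> \<delta>)"
  unfolding Ps_def stable_growth_def[symmetric]
  by (rule Lim_at_right_antimono) (use assms in \<open>auto intro: stable_growth_mono\<close>)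

lemma Ps_mono:
  assumes "x \<in> X" "continuous_on X f" "0 < \<epsilon>" "\<epsilon> \<le> \<epsilon>'"
  shows "Ps T X f x \<epsilon> \<le> Ps T X f x \<epsilon>'"
proof -
  have "0 < \<epsilon>'" using assms(3,4) by simp
  show ?thesis
    unfolding Ps_eq_SUP[OF assms(1,2,3)] Ps_eq_SUP[OF assms(1,2) \<open>0 < \<epsilon>'\<close>]
    using assms by (intro SUP_subset_mono stable_growth_mono) auto
qed

lemma Lim_Ps_eq_INF:
  assumes "x \<in> X" "continuous_on X f"
  shows "Lim (at_right 0) (\<lambda>\<epsilon>. Ps T X f x \<epsilon>) = (INF \<epsilon>\<in>{0<..}. Ps T X f x \<epsilon>)"
  by (rule Lim_at_right_mono) (rule Ps_mono[OF assms])

lemma Ps_ge: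
  assumes x: "x \<in> X" and f: "continuous_on X f" and \<epsilon>: "0 < \<epsilon>" and \<delta>: "0 < \<delta>" and \<kappa>: "0 < \<kappa>"
    and growth: "\<And>m. \<exists>n>m. exp (real n * c) \<le> exp 1 * Pn T f n \<delta> ((T ^^ n) -` stable_set T X x \<epsilon> \<inter> X)"
  shows "ereal (c - \<kappa>) \<le> Ps T X f x \<epsilon>"
proof -
  have "ereal (c - \<kappa>) \<le> stable_growth f x \<epsilon> \<delta>"
    unfolding stable_growth_def
  proof (rule limsup_ge_frequently)
    fix m
    \<comment> \<open>The factor \<open>exp 1\<close> adds 1 / n to the exponent, which \<kappa>
      absorbs for such n.\<close>
    obtain N :: nat where N: "1 / \<kappa> < real N" using reals_Archimedean2 by blast
    obtain n where n: "n > max m N"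
      "exp (real n * c) \<le> exp 1 * Pn T f n \<delta> ((T ^^ n) -` stable_set T X x \<epsilon> \<inter> X)" (is "_ \<le> _ * ?P")
      using growth by blast
    have "0 < ?P"
      using n x f \<delta> \<epsilon> stable_preimage_nonempty[OF x \<epsilon>] by (intro Pn_pos) auto
    then have "real n * c \<le> 1 + ln ?P"
      using ln_mono[OF n(2) exp_gt_zero] by (simp add: ln_mult)
    moreover have "1 \<le> real n * \<kappa>"
    proof -
      have "1 / \<kappa> \<le> real n" using N n(1) by simp
      then show ?thesis using \<kappa> by (simp add: field_simps)
    qed
    ultimately have "real n * (c - \<kappa>) \<le> ln ?P" by (simp add: algebra_simps)
    then have "c - \<kappa> \<le> ln ?P / real n" using n(1) by (simp add: le_divide_eq mult.commute)
    then show "\<exists>n\<ge>m. ereal (c - \<kappa>)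
      \<le> ereal (ln (Pn T f n \<delta> ((T ^^ n) -` stable_set T X x \<epsilon> \<inter> X)) / real n)"
      using n(1) by (intro exI[of _ n]) auto
  qed
  also have "\<dots> \<le> Ps T X f x \<epsilon>"
    unfolding Ps_eq_SUP[OF x f \<epsilon>] using \<delta> by (intro SUP_upper) auto
  finally show ?thesis .
qed

end

section \<open>Entropy of partitions in terms of labels\<close>

context invariant_prob
begin

definition part_label :: "'a set set \<Rightarrow> 'a \<Rightarrow> 'a set" where
  "part_label \<xi> z = (THE A. A \<in> \<xi> \<and> z \<in> A)"

lemma part_label:
  assumes "finite_partition (space M) M \<xi>" "z \<in> space M"
  shows "part_label \<xi> z \<in> \<xi>" "z \<in> part_label \<xi> z"
proof -
  have U: "\<Union>\<xi> = space M" and disj: "\<And>A B. A \<in> \<xi> \<Longrightarrow> B \<in> \<xi> \<Longrightarrow> A \<noteq> B \<Longrightarrow> A \<inter> B = {}"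
    using assms(1) unfolding finite_partition_def by simp_all
  obtain A where A: "A \<in> \<xi>" "z \<in> A" using assms(2) unfolding U[symmetric] by blast
  have "\<exists>!A. A \<in> \<xi> \<and> z \<in> A"
  proof (rule ex1I[of _ A])
    fix B assume B: "B \<in> \<xi> \<and> z \<in> B"
    then show "B = A" using disj[of A B] A by auto
  qed (use A in simp)
  from theI'[OF this] show "part_label \<xi> z \<in> \<xi>" "z \<in> part_label \<xi> z"
    unfolding part_label_def by auto
qed

lemma part_label_eq_iff:
  assumes \<xi>: "finite_partition (space M) M \<xi>" and z: "z \<in> space M" and A: "A \<in> \<xi>"
  shows "part_label \<xi> z = A \<longleftrightarrow> z \<in> A"
proof
  assume "z \<in> A"
  moreover have "\<And>B. B \<in> \<xi> \<Longrightarrow> B \<noteq> A \<Longrightarrow> B \<inter> A = {}"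
    using \<xi> A unfolding finite_partition_def by simp
  ultimately show "part_label \<xi> z = A" using part_label[OF \<xi> z] by blast
qed (use part_label[OF \<xi> z] in auto)

lemma simple_function_part_label:
  assumes \<xi>: "finite_partition (space M) M \<xi>"
  shows "simple_function M (part_label \<xi>)"
  unfolding simple_function_def
proof (intro conjI ballI)
  have sub: "part_label \<xi> ` space M \<subseteq> \<xi>" using part_label[OF \<xi>] by auto
  then show "finite (part_label \<xi> ` space M)"
    using \<xi> unfolding finite_partition_def by (auto intro: finite_subset)
  fix A assume "A \<in> part_label \<xi> ` space M"
  then have A: "A \<in> \<xi>" using sub by auto
  then have "A \<in> sets M" using \<xi> unfolding finite_partition_def by auto
  moreover have "part_label \<xi> -` {A} \<inter> space M = A"
    using part_label_eq_iff[OF \<xi> _ A] sets.sets_into_space[OF \<open>A \<in> sets M\<close>] by auto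
  ultimately show "part_label \<xi> -` {A} \<inter> space M \<in> sets M" by simp
qed

lemma part_entropy_fibers:
  assumes r: "simple_function M r"
  shows "part_entropy M ((\<lambda>w. {y \<in> space M. r y = w}) ` r ` space M) = (\<integral>z. - ln (fiber_prob r z) \<partial>M)"
proof -
  let ?F = "\<lambda>w. {y \<in> space M. r y = w}"
  have inj: "inj_on ?F (r ` space M)" by (rule inj_onI) blast
  have "(\<integral>z. - ln (fiber_prob r z) \<partial>M) = (\<Sum>w\<in>r ` space M. - ln (prob (?F w)) * prob (?F w))"
    unfolding fiber_prob_def using simple_function_integral(2)[OF r, of "\<lambda>w. - ln (prob (?F w))"] .
  also have "\<dots> = part_entropy M (?F ` r ` space M)"
    unfolding part_entropy_def by (simp add: sum.reindex[OF inj] sum_negf mult.commute)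
  finally show ?thesis by simp
qed

text \<open>For n = 0 the intersection over no indices is the whole type instead of the space, hence
  the condition on n. Removing the empty set from the join matches taking only words that
  occur.\<close>

lemma join_part_eq:
  assumes \<xi>: "finite_partition (space M) M \<xi>" and n: "0 < n"
  shows "join_part (space M) T \<xi> n
    = (\<lambda>w. {y \<in> space M. wrd T (part_label \<xi>) n y = w}) ` wrd T (part_label \<xi>) n ` space M"
    (is "_ = ?R")
proof (intro equalityI subsetI)
  fix D assume "D \<in> join_part (space M) T \<xi> n"
  then obtain a where a: "D = (\<Inter>i<n. (T ^^ i) -` a i \<inter> space M)" "\<forall>i<n. a i \<in> \<xi>" and "D \<noteq> {}"
    unfolding join_part_def by blast
  then obtain z where z: "z \<in> D" by blast
  have DX: "y \<in> D \<longleftrightarrow> y \<in> space M \<and> (\<forall>i<n. part_label \<xi> ((T ^^ i) y) = a i)" for y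
  proof -
    have "y \<in> D \<longleftrightarrow> y \<in> space M \<and> (\<forall>i<n. (T ^^ i) y \<in> a i)"
      unfolding a(1) using n by auto
    moreover have "part_label \<xi> ((T ^^ i) y) = a i \<longleftrightarrow> (T ^^ i) y \<in> a i" if "y \<in> space M" "i < n" for i
      using part_label_eq_iff[OF \<xi> funpow_space[OF that(1)]] a(2) that(2) by blast
    ultimately show ?thesis by (cases "y \<in> space M") simp_all
  qed
  then have "D = {y \<in> space M. wrd T (part_label \<xi>) n y = wrd T (part_label \<xi>) n z}"
    using z by (auto simp: wrd_eq_iff)
  moreover have "z \<in> space M" using z DX by blast
  ultimately show "D \<in> ?R" by blast
next
  fix D assume "D \<in> ?R"
  then obtain z where z: "z \<in> space M" "D = {y \<in> space M. wrd T (part_label \<xi>) n y = wrd T (part_label \<xi>) n z}"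
    by blast
  define a where "a i = part_label \<xi> ((T ^^ i) z)" for i
  have a: "a i \<in> \<xi>" for i unfolding a_def by (intro part_label[OF \<xi>] funpow_space z)
  have "D = (\<Inter>i<n. (T ^^ i) -` a i \<inter> space M)"
  proof (rule set_eqI)
    fix y
    have "y \<in> D \<longleftrightarrow> y \<in> space M \<and> (\<forall>i<n. part_label \<xi> ((T ^^ i) y) = a i)"
      unfolding z(2) a_def by (simp add: wrd_eq_iff)
    moreover have "y \<in> (\<Inter>i<n. (T ^^ i) -` a i \<inter> space M) \<longleftrightarrow> y \<in> space M \<and> (\<forall>i<n. (T ^^ i) y \<in> a i)"
      using n by auto
    moreover have "part_label \<xi> ((T ^^ i) y) = a i \<longleftrightarrow> (T ^^ i) y \<in> a i" if "y \<in> space M" for i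
      using part_label_eq_iff[OF \<xi> funpow_space[OF that] a] .
    ultimately show "y \<in> D \<longleftrightarrow> y \<in> (\<Inter>i<n. (T ^^ i) -` a i \<inter> space M)"
      by (cases "y \<in> space M") simp_all
  qed
  moreover have "D \<noteq> {}" using z by auto
  ultimately show "D \<in> join_part (space M) T \<xi> n" unfolding join_part_def using a by blast
qed

text \<open>This also shows that the \<open>lim\<close> in \<open>entropy_rel\<close> is a genuine
  limit.\<close>

lemma entropy_rel_eq:
  assumes \<xi>: "finite_partition (space M) M \<xi>"
  shows "entropy_rel (space M) T M \<xi> = entropy_rate (part_label \<xi>)"
  unfolding entropy_rel_def
proof (rule limI)
  have eq: "word_entropy (part_label \<xi>) n = part_entropy M (join_part (space M) T \<xi> n)" if "0 < n" for n
    unfolding join_part_eq[OF \<xi> that] word_entropy_def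
    by (rule part_entropy_fibers[OF simple_function_wrd[OF simple_function_part_label[OF \<xi>]], symmetric])
  show "(\<lambda>n. part_entropy M (join_part (space M) T \<xi> n) / real n) \<longlonglongrightarrow> entropy_rate (part_label \<xi>)"
    by (rule Lim_transform_eventually[OF word_entropy_LIMSEQ[OF simple_function_part_label[OF \<xi>]]])
      (auto simp: eq intro!: eventually_sequentiallyI[of 1])
qed

end

section \<open>From single partitions to the measure-theoretic pressure\<close>

context ergodic_compact_system
begin

text \<open>Each point is labelled by the set of all balls of a finite cover that contain it. Equal
  labels share a ball, and the cover need not be made disjoint.\<close>

lemma fine_simple_function:
  assumes \<epsilon>: "0 < \<epsilon>"
  shows "\<exists>b :: 'a \<Rightarrow> 'a set. simple_function M b \<and>
    (\<forall>y\<in>space M. \<forall>z\<in>space M. b y = b z \<longrightarrow> dist y z \<le> \<epsilon>)"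
proof -
  obtain F where F: "finite F" "space M \<subseteq> (\<Union>c\<in>F. ball c (\<epsilon> / 2))"
  proof (rule compactE_image[OF compact_space, of "space M" "\<lambda>c. ball c (\<epsilon> / 2)"])
    show "space M \<subseteq> (\<Union>c\<in>space M. ball c (\<epsilon> / 2))" using \<epsilon> by auto
  qed auto
  define b where "b z = {c \<in> F. z \<in> ball c (\<epsilon> / 2)}" for z
  have "simple_function M b"
    unfolding simple_function_def
  proof (intro conjI ballI)
    show "finite (b ` space M)"
      by (rule finite_subset[of _ "Pow F"]) (use F(1) in \<open>auto simp: b_def\<close>)
    fix v
    have ball: "space M \<inter> ball c (\<epsilon> / 2) \<in> sets M" for c
      unfolding sets_M sets_restrict_space by auto
    have "{z \<in> space M. (z \<in> ball c (\<epsilon> / 2)) = (c \<in> v)} \<in> sets M" for c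
    proof (cases "c \<in> v")
      case True
      then show ?thesis using ball[of c] by (simp add: Int_def)
    next
      case False
      then have "{z \<in> space M. (z \<in> ball c (\<epsilon> / 2)) = (c \<in> v)} = space M - (space M \<inter> ball c (\<epsilon> / 2))"
        by auto
      then show ?thesis using ball[of c] by (simp only: sets.compl_sets)
    qed
    then have "{z \<in> space M. \<forall>c\<in>F. (z \<in> ball c (\<epsilon> / 2)) = (c \<in> v)} \<in> sets M"
      using F(1) by (intro sets.sets_Collect_finite_All) auto
    moreover have "b z = v \<longleftrightarrow> v \<subseteq> F \<and> (\<forall>c\<in>F. (z \<in> ball c (\<epsilon> / 2)) = (c \<in> v))" for z
      unfolding b_def by blast
    then have "b -` {v} \<inter> space M = (if v \<subseteq> F
        then {z \<in> space M. \<forall>c\<in>F. (z \<in> ball c (\<epsilon> / 2)) = (c \<in> v)} else {})"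
      by (simp add: vimage_def Int_def conj_commute)
    ultimately show "b -` {v} \<inter> space M \<in> sets M" by simp
  qed
  moreover have "dist y z \<le> \<epsilon>" if yz: "y \<in> space M" "z \<in> space M" "b y = b z" for y z
  proof -
    obtain c where c: "c \<in> F" "y \<in> ball c (\<epsilon> / 2)" using F(2) yz(1) by blast
    then have "c \<in> b z" using yz(3) by (auto simp: b_def)
    then have "dist c z < \<epsilon> / 2" "dist c y < \<epsilon> / 2" using c by (auto simp: b_def)
    then show ?thesis using dist_triangle2[of y z c] by (simp add: dist_commute)
  qed
  ultimately show ?thesis by blast
qed

text \<open>The given partition supplies the entropy and the fine labelling supplies the diameter;
  pairing the labels gives both, as refinement does not decrease the entropy.\<close>

lemma AE_Ps_ge:
  assumes \<xi>: "finite_partition (space M) M \<xi>" and f: "continuous_on (space M) f"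
    and \<epsilon>: "0 < \<epsilon>" and \<kappa>: "0 < \<kappa>"
  shows "AE x in M. ereal (entropy_rel (space M) T M \<xi> + (\<integral>x. f x \<partial>M) - \<kappa>) \<le> Ps T (space M) f x \<epsilon>"
proof -
  obtain b :: "'a \<Rightarrow> 'a set" where b: "simple_function M b"
    "\<And>y z. y \<in> space M \<Longrightarrow> z \<in> space M \<Longrightarrow> b y = b z \<Longrightarrow> dist y z \<le> \<epsilon>"
    using fine_simple_function[OF \<epsilon>] by blast
  note a = simple_function_part_label[OF \<xi>]
  define q where "q z = (part_label \<xi> z, b z)" for z
  have q: "simple_function M q"
    unfolding q_def using simple_function_compose2[OF a b(1), of Pair] .
  have h: "entropy_rel (space M) T M \<xi> \<le> entropy_rate q"
    unfolding entropy_rel_eq[OF \<xi>]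
    by (rule entropy_rate_mono[OF a q, where \<phi> = fst]) (simp add: q_def)
  have \<kappa>2: "0 < \<kappa> / 2" using \<kappa> by simp
  obtain \<delta> where \<delta>: "0 < \<delta>" and ae: "AE x in M. \<forall>m. \<exists>n>m.
      exp (real n * (entropy_rate q + (\<integral>x. f x \<partial>M) - \<kappa> / 2))
      \<le> exp 1 * Pn T f n \<delta> ((T ^^ n) -` stable_set T (space M) x \<epsilon> \<inter> space M)"
    using AE_frequently_Pn_stable[OF q f \<kappa>2, of \<epsilon>] b(2) unfolding q_def by auto
  have "AE x in M. x \<in> space M" by simp
  with ae show ?thesis
  proof eventually_elim
    case (elim x)
    have "ereal (entropy_rel (space M) T M \<xi> + (\<integral>x. f x \<partial>M) - \<kappa>)
        \<le> ereal (entropy_rate q + (\<integral>x. f x \<partial>M) - \<kappa> / 2 - \<kappa> / 2)" using h by simp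
    also have "\<dots> \<le> Ps T (space M) f x \<epsilon>"
      by (rule Ps_ge[OF elim(2) f \<epsilon> \<delta> \<kappa>2]) (use elim(1) in blast)
    finally show ?case .
  qed
qed

text \<open>The null set depends on \<epsilon> and on the loss, so both are taken along the sequence
  1 / (j + 1); monotonicity in \<epsilon> covers the other values.\<close>

lemma AE_Lim_Ps_ge:
  assumes \<xi>: "finite_partition (space M) M \<xi>" and f: "continuous_on (space M) f"
  shows "AE x in M. ereal (entropy_rel (space M) T M \<xi> + (\<integral>x. f x \<partial>M))
    \<le> Lim (at_right 0) (\<lambda>\<epsilon>. Ps T (space M) f x \<epsilon>)"
proof -
  let ?c = "entropy_rel (space M) T M \<xi> + (\<integral>x. f x \<partial>M)"
  let ?e = "\<lambda>j. 1 / real (Suc j)"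
  have "AE x in M. \<forall>j. ereal (?c - ?e j) \<le> Ps T (space M) f x (?e j)"
    unfolding AE_all_countable by (intro allI AE_Ps_ge[OF \<xi> f]) auto
  moreover have "AE x in M. x \<in> space M" by simp
  ultimately show ?thesis
  proof eventually_elim
    case (elim x)
    show ?case
      unfolding Lim_Ps_eq_INF[OF elim(2) f]
    proof (rule INF_greatest)
      fix \<epsilon> :: real assume "\<epsilon> \<in> {0<..}"
      then have \<epsilon>: "0 < \<epsilon>" by simp
      show "ereal ?c \<le> Ps T (space M) f x \<epsilon>"
      proof (rule ereal_le_epsilon2)
        fix e :: real assume "0 < e"
        then obtain j where j: "?e j < min \<epsilon> e" using \<epsilon> nat_approx_posE[of "min \<epsilon> e"] by auto
        have "ereal ?c \<le> ereal (?c - ?e j) + ereal e" using j by simp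
        also have "\<dots> \<le> Ps T (space M) f x (?e j) + ereal e" using elim(1) by (intro add_right_mono) simp
        also have "Ps T (space M) f x (?e j) \<le> Ps T (space M) f x \<epsilon>"
          using elim(2) f j by (intro Ps_mono) auto
        finally show "ereal ?c \<le> Ps T (space M) f x \<epsilon> + ereal e" by (simp add: add_right_mono)
      qed
    qed
  qed
qed

lemma AE_Lim_Ps_ge_measure_pressure:
  assumes f: "continuous_on (space M) f"
  shows "AE x in M. measure_pressure (space M) T f M \<le> Lim (at_right 0) (\<lambda>\<epsilon>. Ps T (space M) f x \<epsilon>)"
proof -
  let ?P = "{\<xi>. finite_partition (space M) M \<xi>}"
  let ?h = "\<lambda>\<xi>. ereal (entropy_rel (space M) T M \<xi>)"
  have "{space M} \<in> ?P" by (simp add: finite_partition_def not_empty[symmetric])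
  then have "?h ` ?P \<noteq> {}" by blast
  \<comment> \<open>Uncountably many partitions would give uncountably many null sets; the supremum
    is already reached along a sequence of them.\<close>
  from Sup_countable_SUP[OF this] obtain g :: "nat \<Rightarrow> ereal"
    where g: "range g \<subseteq> ?h ` ?P" "Sup (?h ` ?P) = (SUP i. g i)"
    by (elim exE conjE)
  have "\<forall>i. \<exists>\<xi>. finite_partition (space M) M \<xi> \<and> g i = ?h \<xi>"
  proof
    fix i
    have "g i \<in> ?h ` ?P" by (rule subsetD[OF g(1) rangeI])
    then show "\<exists>\<xi>. finite_partition (space M) M \<xi> \<and> g i = ?h \<xi>" by auto
  qed
  from choice[OF this] obtain \<xi> where \<xi>: "\<And>i. finite_partition (space M) M (\<xi> i)" "\<And>i. g i = ?h (\<xi> i)"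
    by auto
  have "AE x in M. \<forall>i. ereal (entropy_rel (space M) T M (\<xi> i) + (\<integral>x. f x \<partial>M))
    \<le> Lim (at_right 0) (\<lambda>\<epsilon>. Ps T (space M) f x \<epsilon>)"
    unfolding AE_all_countable by (intro allI AE_Lim_Ps_ge[OF \<xi>(1) f])
  then show ?thesis
  proof eventually_elim
    case (elim x)
    let ?L = "Lim (at_right 0) (\<lambda>\<epsilon>. Ps T (space M) f x \<epsilon>)"
    \<comment> \<open>The integral is finite, so it may change sides even if the entropy is
      infinite.\<close>
    have "(SUP i. g i) \<le> ?L - ereal (\<integral>x. f x \<partial>M)"
    proof (rule SUP_least)
      fix i show "g i \<le> ?L - ereal (\<integral>x. f x \<partial>M)"
        unfolding \<xi>(2) using elim[rule_format, of i] by (subst ereal_le_minus) auto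
    qed
    then have "(SUP i. g i) + ereal (\<integral>x. f x \<partial>M) \<le> ?L" by (subst (asm) ereal_le_minus) auto
    then show ?case unfolding measure_pressure_def ks_entropy_def g(2) .
  qed
qed

end

theorem theorem3p6:
  fixes X :: "'a::metric_space set" and T :: "'a \<Rightarrow> 'a" and f :: "'a \<Rightarrow> real"
    and \<mu> :: "'a measure"
  assumes "tds X T"
    and "continuous_on X f"
    and "borel_prob_on X \<mu>"
    and "ergodic_measure X T \<mu>"
    and "ks_entropy X T \<mu> > 0"
  shows "AE x in \<mu>. Lim (at_right 0) (\<lambda>\<epsilon>. Ps T X f x \<epsilon>) \<ge> measure_pressure X T f \<mu>"
proof -
  have X: "compact X" "continuous_on X T" "T ` X = X"
    using assms(1) unfolding tds_def homeomorphism_def by blast+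
  have \<mu>: "prob_space \<mu>" "space \<mu> = X" "sets \<mu> = sets (restrict_space borel X)"
    using assms(3) unfolding borel_prob_on_def by auto
  have T: "T \<in> \<mu> \<rightarrow>\<^sub>M \<mu>"
  proof -
    have "T \<in> restrict_space borel X \<rightarrow>\<^sub>M restrict_space borel X"
      using borel_measurable_continuous_on_restrict[OF X(2)] X(3)
      by (intro measurable_restrict_space2) (auto simp: space_restrict_space)
    then show ?thesis using measurable_cong_sets[OF \<mu>(3) \<mu>(3)] by blast
  qed
  interpret prob_space \<mu> by (rule \<mu>(1))
  interpret ergodic_compact_system \<mu> T
    by unfold_locales (use T X \<mu> assms(4) in \<open>auto simp: ergodic_measure_def invariant_measure_def\<close>)
  show ?thesis using AE_Lim_Ps_ge_measure_pressure assms(2) unfolding \<mu>(2) by blast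
qed

end
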